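(* Let $p$ be a prime and let $G$ be a finite abelian $p$-group. Then the number of diamonds in the subgroup lattice of $G$ is $$dm(G)=\sum_{S} n_{S\times S}(G)\,\frac{|\mathrm{Aut}(S\times S)|}{6\,|\mathrm{Aut}(S)|},$$ where $S$ runs over all types of sections $S$ of $G$, and the numbers $n_{S\times S}(G)$ (the number of sections of $G$ isomorphic to $S\times S$) are given by $$n_{S\times S}(G)=\sum_{T\le G,\ T\cong S\times S}|L(G/T)|$$ (an empty sum being $0$).
   Context: For a finite group $G$, $L(G)$ denotes the lattice of all subgroups of $G$ (meet $A\wedge B=A\cap B$, join $A\vee B=\langle A,B\rangle$), and $|L(G)|$ is the number of subgroups. A diamond of $G$ is a sublattice of $L(G)$ isomorphic to the diamond lattice $M_5$ (the five-element lattice with a bottom, a top and three pairwise incomparable elements, any two of which meet in the bottom and join to the top). Such a sublattice is determined by a triple $(A,B,C)$ of subgroups of $G$ (its three middle elements, whose order does not matter) satisfying $A\wedge B=B\wedge C=C\wedge A$ and $A\vee B=B\vee C=C\vee A$. $dm(G)$ denotes the number of diamonds of $G$. A section of $G$ is a quotient $K/H$ of a subgroup of $G$, determined by a pair $(H,K)$ of subgroups of $G$ with $H\subseteq K$; sections are counted as pairs $(H,K)$, and the section is said to be isomorphic to a group $X$ if $K/H\cong X$. Types of sections are isomorphism types. $\mathrm{Aut}(X)$ is the automorphism group of $X$.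
   Formalization: In the formula for dm(G), S runs only over the nontrivial types of sections: the trivial type would add |L(G)|/6 and make the formula false (e.g. for G = 1, where dm(G) = 0). *)

theory Defs
  imports "HOL-Algebra.Algebra" "HOL-Computational_Algebra.Primes"
begin

section \<open>The subgroup lattice and its diamonds\<close>

definition subgroup_lattice :: "('a, 'b) monoid_scheme \<Rightarrow> 'a set set" where
  "subgroup_lattice G = {H. subgroup H G}"

definition subgroup_join :: "('a, 'b) monoid_scheme \<Rightarrow> 'a set \<Rightarrow> 'a set \<Rightarrow> 'a set" where
  "subgroup_join G A B = generate G (A \<union> B)"

definition is_sublattice :: "('a, 'b) monoid_scheme \<Rightarrow> 'a set set \<Rightarrow> bool" where
  "is_sublattice G D \<longleftrightarrow> D \<noteq> {} \<and> D \<subseteq> subgroup_lattice G \<and>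
     (\<forall>A\<in>D. \<forall>B\<in>D. A \<inter> B \<in> D \<and> subgroup_join G A B \<in> D)"

datatype m5 = Bottom | Mid1 | Mid2 | Mid3 | Top

instantiation m5 :: lattice
begin

definition less_eq_m5 :: "m5 \<Rightarrow> m5 \<Rightarrow> bool" where
  "x \<le> y \<longleftrightarrow> x = Bottom \<or> y = Top \<or> x = y" for x y :: m5

definition less_m5 :: "m5 \<Rightarrow> m5 \<Rightarrow> bool" where
  "x < y \<longleftrightarrow> x \<le> y \<and> x \<noteq> y" for x y :: m5

definition inf_m5 :: "m5 \<Rightarrow> m5 \<Rightarrow> m5" where
  "inf x y = (if x \<le> y then x else if y \<le> x then y else Bottom)" for x y :: m5

definition sup_m5 :: "m5 \<Rightarrow> m5 \<Rightarrow> m5" where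
  "sup x y = (if x \<le> y then y else if y \<le> x then x else Top)" for x y :: m5

instance
proof
  fix x y z :: m5
  show "(x < y) = (x \<le> y \<and> \<not> y \<le> x)"
    by (auto simp: less_eq_m5_def less_m5_def)
  show "x \<le> x" "x \<le> y \<Longrightarrow> y \<le> z \<Longrightarrow> x \<le> z" "x \<le> y \<Longrightarrow> y \<le> x \<Longrightarrow> x = y"
    by (auto simp: less_eq_m5_def)
  show "inf x y \<le> x" "inf x y \<le> y" "x \<le> sup x y" "y \<le> sup x y"
    by (simp_all add: less_eq_m5_def inf_m5_def sup_m5_def)
  show "x \<le> y \<Longrightarrow> x \<le> z \<Longrightarrow> x \<le> inf y z" "y \<le> x \<Longrightarrow> z \<le> x \<Longrightarrow> sup y z \<le> x"
    by (cases x; cases y; cases z; simp add: less_eq_m5_def inf_m5_def sup_m5_def)+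
qed

end

definition is_diamond :: "('a, 'b) monoid_scheme \<Rightarrow> 'a set set \<Rightarrow> bool" where
  "is_diamond G D \<longleftrightarrow> is_sublattice G D \<and>
     (\<exists>f. bij_betw f (UNIV :: m5 set) D \<and>
        (\<forall>x y. f (inf x y) = f x \<inter> f y \<and> f (sup x y) = subgroup_join G (f x) (f y)))"

definition dm :: "('a, 'b) monoid_scheme \<Rightarrow> nat" where
  "dm G = card {D. is_diamond G D}"


section \<open>Sections and their isomorphism types\<close>

text \<open>The normality of \<open>H\<close> in \<open>K\<close>, needed for the quotient to make sense, is automatic when
  \<open>G\<close> is commutative (see \<open>sections_comm\<close> below).\<close>

definition sections :: "('a, 'b) monoid_scheme \<Rightarrow> ('a set \<times> 'a set) set" where
  "sections G = {(H, K). subgroup H G \<and> subgroup K G \<and> H \<subseteq> K \<and> normal H (G\<lparr>carrier := K\<rparr>)}"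

fun section_group :: "('a, 'b) monoid_scheme \<Rightarrow> 'a set \<times> 'a set \<Rightarrow> 'a set monoid" where
  "section_group G (H, K) = G\<lparr>carrier := K\<rparr> Mod H"

definition n_sections :: "('a, 'b) monoid_scheme \<Rightarrow> ('c, 'd) monoid_scheme \<Rightarrow> nat" where
  "n_sections G Q = card {s \<in> sections G. section_group G s \<cong> Q}"

definition section_iso :: "('a, 'b) monoid_scheme \<Rightarrow> (('a set \<times> 'a set) \<times> ('a set \<times> 'a set)) set" where
  "section_iso G = {(s, t). s \<in> sections G \<and> t \<in> sections G \<and> section_group G s \<cong> section_group G t}"

text \<open>An isomorphism type is represented by a chosen group of that type, so that this set is
  a system of representatives of the sections of \<open>G\<close> up to isomorphism (see \<open>section_types_ex1\<close>
  below). The trivial type is included; it has to be left out when counting diamonds, because the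
  sections between the bottom and a middle element of a diamond are nontrivial.\<close>

definition section_types :: "('a, 'b) monoid_scheme \<Rightarrow> 'a set monoid set" where
  "section_types G = (\<lambda>c. section_group G (SOME s. s \<in> c)) ` (sections G // section_iso G)"

lemma sections_comm:
  assumes "comm_group G"
  shows "sections G = {(H, K). subgroup H G \<and> subgroup K G \<and> H \<subseteq> K}"
proof -
  interpret comm_group G by fact
  have "normal H (G\<lparr>carrier := K\<rparr>)" if "subgroup H G" "subgroup K G" "H \<subseteq> K" for H K
  proof -
    have "comm_group (G\<lparr>carrier := K\<rparr>)"
      using that(2)
      by (intro group.group_comm_groupI subgroup_imp_group)
        (auto intro: m_comm subgroup.mem_carrier)
    moreover have "subgroup H (G\<lparr>carrier := K\<rparr>)"
      using that subgroup_incl by blast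
    ultimately show ?thesis
      by (simp add: comm_group.subgroup_imp_normal)
  qed
  then show ?thesis by (auto simp: sections_def)
qed

lemma group_section_group: "s \<in> sections G \<Longrightarrow> group (section_group G s)"
  by (auto simp: sections_def intro: normal.factorgroup_is_group)

lemma equiv_section_iso: "equiv (sections G) (section_iso G)"
proof (rule equivI)
  show "section_iso G \<subseteq> sections G \<times> sections G"
    by (auto simp: section_iso_def)
  show "refl_on (sections G) (section_iso G)"
    by (auto simp: refl_on_def section_iso_def iso_refl)
  show "sym (section_iso G)"
    unfolding sym_def section_iso_def using group.iso_sym group_section_group by blast
  show "trans (section_iso G)"
    unfolding trans_def section_iso_def using iso_trans by blast
qed

lemma section_types_ex1:
  assumes s: "s \<in> sections G"
  shows "\<exists>!S. S \<in> section_types G \<and> section_group G s \<cong> S"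
proof -
  define rep where "rep c = (SOME s. s \<in> c)" for c :: "('a set \<times> 'a set) set"
  have rep: "rep c \<in> c" if "c \<in> sections G // section_iso G" for c
    using in_quotient_imp_non_empty[OF equiv_section_iso that] unfolding rep_def
    by (simp add: some_in_eq)
  have types: "section_types G = (\<lambda>c. section_group G (rep c)) ` (sections G // section_iso G)"
    by (simp add: section_types_def rep_def)
  define c where "c = section_iso G `` {s}"
  have c: "c \<in> sections G // section_iso G"
    using s by (simp add: c_def quotientI)
  have iso: "section_group G s \<cong> section_group G (rep c)"
    using rep[OF c] by (auto simp: c_def section_iso_def)
  have uniq: "S = section_group G (rep c)"
    if S: "S \<in> section_types G" "section_group G s \<cong> S" for S
  proof -
    obtain d where d: "d \<in> sections G // section_iso G" and Sd: "S = section_group G (rep d)"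
      using S(1) types by auto
    have "rep d \<in> sections G"
      using rep[OF d] d equiv_section_iso in_quotient_imp_subset by blast
    hence "(s, rep d) \<in> section_iso G"
      using s S(2) Sd by (simp add: section_iso_def)
    moreover have "s \<in> c"
      unfolding c_def by (rule equiv_class_self[OF equiv_section_iso s])
    ultimately have "c = d"
      using quotient_eqI[OF equiv_section_iso c d _ rep[OF d]] by blast
    thus ?thesis by (simp add: Sd)
  qed
  show ?thesis
    using iso uniq c types by (intro ex1I[of _ "section_group G (rep c)"]) auto
qed

end

theory Submission
  imports Defs
begin

text \<open>A diamond with bottom \<open>H\<close> and top \<open>K\<close> amounts to three pairwise complementary subgroups of
  \<open>K/H\<close>. They are all isomorphic to one group \<open>S\<close>, with \<open>K/H \<cong> S \<times> S\<close>. An isomorphism from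
  \<open>S \<times> S\<close> to \<open>K/H\<close> is the same as an ordered such triple (the images of the two factors and of the
  diagonal) together with an isomorphism from \<open>S\<close> to its first member, so there are
  \<open>|Aut(S \<times> S)| / |Aut(S)|\<close> ordered triples of type \<open>S\<close>.

  For the number of sections of type \<open>Q\<close>, an isomorphism of a finite abelian \<open>p\<close>-group \<open>K\<close> with its
  character group (obtained by splitting off a cyclic subgroup of maximal order) provides a
  bijection \<open>H \<mapsto> H\<^sup>\<bottom>\<close> on the subgroups of \<open>K\<close> with \<open>K/H \<cong> H\<^sup>\<bottom>\<close>. Hence \<open>K\<close> has as many quotients
  as subgroups of type \<open>Q\<close>, and summing over \<open>K\<close> counts the pairs \<open>T \<subseteq> K\<close> with \<open>T \<cong> Q\<close>.\<close>

text \<open>If \<open>A\<close> and \<open>B\<close> are complementary, a third subgroup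
  \<open>C\<close> complementary to both is the graph of an isomorphism from \<open>A\<close> to
  \<open>B\<close>. This is why a triple forces the shape S x S and why the diagonal appears: once
  \<open>A\<close> is identified with \<open>S\<close>, the coordinates on \<open>B\<close> are read
  off from \<open>C\<close>. The denominator 6 is the number of orderings of the three middle
  elements. For trivial \<open>S\<close> the only triples are those with A = B = C, which span no
  diamond; hence the restriction \<open>order S \<noteq> 1\<close>. In the section count the
  obstacle is that no natural map exchanges quotients of \<open>K\<close> with subgroups of
  \<open>K\<close>. The isomorphism with the character group depends on choices, so the argument
  rests on the cardinality of annihilators and not on a canonical pairing.\<close>

section \<open>Splitting off a cyclic direct factor\<close>

text \<open>If \<open>g\<close> has maximal order and \<open>K\<close> is maximal with \<open>\<langle>g\<rangle> \<inter> K = \<one>\<close>, then \<open>\<langle>g\<rangle>K\<close> is the whole group: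
  otherwise some \<open>x \<notin> \<langle>g\<rangle>K\<close> has \<open>x\<^sup>p \<in> \<langle>g\<rangle>K\<close>, maximality of the order makes the \<open>\<langle>g\<rangle>\<close>-part of \<open>x\<^sup>p\<close> a
  \<open>p\<close>-th power, and dividing \<open>x\<close> by its root gives \<open>y\<close> that can be adjoined to \<open>K\<close>.\<close>

lemma (in comm_group) primary_cyclic_complement:
  fixes p k :: nat
  assumes p: "Factorial_Ring.prime p" and fin: "finite (carrier G)" and ordG: "order G = p ^ k"
  obtains g K where "g \<in> carrier G" "subgroup K G" "generate G {g} \<inter> K = {\<one>}"
    "generate G {g} <#> K = carrier G" "\<And>x. x \<in> carrier G \<Longrightarrow> x [^] ord g = \<one>"
proof -
  have ord_pp: "\<exists>i. ord x = p ^ i" if "x \<in> carrier G" for x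
    using ord_dvd_group_order[OF that] p unfolding ordG
    by (auto simp: divides_primepow_nat)
  define n where "n = Max (ord ` carrier G)"
  have "n \<in> ord ` carrier G"
    unfolding n_def using fin by (intro Max_in) auto
  then obtain g where g: "g \<in> carrier G" and ordg: "ord g = n" by auto
  obtain e where e: "n = p ^ e" using ord_pp[OF g] ordg by auto
  \<comment> \<open>All orders are powers of \<open>p\<close>, hence linearly ordered by
    divisibility, so the maximal order \<open>n\<close> is an exponent of the group.\<close>
  have expo: "x [^] n = \<one>" if x: "x \<in> carrier G" for x
  proof -
    obtain i where i: "ord x = p ^ i" using ord_pp[OF x] by auto
    have "ord x \<le> n" unfolding n_def using fin x by auto
    then have "i \<le> e" using p unfolding i e by (meson power_le_imp_le_exp prime_gt_1_nat)
    then have "ord x dvd n" unfolding i e by (rule le_imp_power_dvd)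
    then show ?thesis using pow_eq_id[OF x] by simp
  qed
  define C where "C = generate G {g}"
  have C: "subgroup C G" unfolding C_def using g by (simp add: generate_is_subgroup)
  have Cpow: "C = {g [^] i | i. i \<in> (UNIV :: nat set)}"
    unfolding C_def by (rule generate_pow_on_finite_carrier[OF fin g])
  define F where "F = {K. subgroup K G \<and> C \<inter> K = {\<one>}}"
  have finF: "finite F" unfolding F_def
    by (rule rev_finite_subset[of "Pow (carrier G)"]) (auto simp: fin dest: subgroup.subset)
  have "{\<one>} \<in> F" unfolding F_def
    using triv_subgroup subgroup.one_closed[OF C] by auto
  then have "Max (card ` F) \<in> card ` F" using finF by (intro Max_in) auto
  then obtain K where KF: "K \<in> F" and Kmax: "card K = Max (card ` F)" by auto
  have K: "subgroup K G" and CK: "C \<inter> K = {\<one>}" using KF by (auto simp: F_def)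
  define M where "M = C <#> K"
  have M: "subgroup M G" unfolding M_def by (rule mult_subgroups[OF C K])
  have M_iff: "x \<in> M \<longleftrightarrow> (\<exists>c\<in>C. \<exists>h\<in>K. x = c \<otimes> h)" for x
    by (auto simp: M_def set_mult_def)
  have CM: "C \<subseteq> M"
    using subgroup.one_closed[OF K] subgroup.mem_carrier[OF C] unfolding M_iff subset_eq
    by (metis r_one)
  have KM: "K \<subseteq> M"
    using subgroup.one_closed[OF C] subgroup.mem_carrier[OF K] unfolding M_iff subset_eq
    by (metis l_one)
  have pow_mem: "x [^] (i::nat) \<in> H" if "subgroup H G" "x \<in> H" for x i H
    using that by (induction i) (auto intro: subgroup.one_closed subgroup.m_closed)
  have "M = carrier G"
  proof (rule ccontr)
    assume "M \<noteq> carrier G"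
    then obtain z where z: "z \<in> carrier G" "z \<notin> M" using subgroup.subset[OF M] by auto
    \<comment> \<open>Minimality of \<open>j\<close> makes \<open>x\<close>, the last term of the
      chain z, z^p, z^(p^2), ... outside \<open>M\<close>, an element of order \<open>p\<close>
      modulo \<open>M\<close>.\<close>
    define j where "j = (LEAST j. z [^] (p ^ j) \<in> M)"
    have "z [^] (p ^ k) \<in> M"
      using pow_order_eq_1[OF z(1)] subgroup.one_closed[OF M] by (simp add: ordG)
    then have jM: "z [^] (p ^ j) \<in> M" unfolding j_def by (rule LeastI)
    with z have "j \<noteq> 0" by (auto intro: Nat.gr0I)
    then obtain l where l: "j = Suc l" by (cases j) auto
    define x where "x = z [^] (p ^ l)"
    have xM: "x \<notin> M"
      using not_less_Least[of l "\<lambda>j. z [^] (p ^ j) \<in> M"] l unfolding x_def j_def by auto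
    have x: "x \<in> carrier G" unfolding x_def using z by simp
    have "x [^] p \<in> M" using jM z unfolding x_def l by (simp add: nat_pow_pow mult.commute)
    then obtain c h where c: "c \<in> C" and h: "h \<in> K" and xp: "x [^] p = c \<otimes> h"
      unfolding M_iff by auto
    have ch: "c \<in> carrier G" "h \<in> carrier G"
      using c h subgroup.mem_carrier[OF C] subgroup.mem_carrier[OF K] by auto
    have "e \<noteq> 0"
    proof
      assume "e = 0"
      then have "x = \<one>" using expo[OF x] x e by simp
      with xM subgroup.one_closed[OF M] show False by simp
    qed
    then obtain m where m: "n = p * m" and m0: "m \<noteq> 0"
      using p unfolding e by (cases e) (auto simp: prime_gt_0_nat)
    \<comment> \<open>Here \<open>m\<close> is n / p, so raising x^p = c h to the power
      \<open>m\<close> gives x^n = 1. The trivial intersection kills c^m; since c = g^i and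
      \<open>g\<close> has order p m, it follows that \<open>p\<close> divides
      \<open>i\<close>.\<close>
    have "\<one> = c [^] m \<otimes> h [^] m"
      using expo[OF x] x ch xp m by (metis nat_pow_pow nat_pow_distrib)
    then have "c [^] m = inv (h [^] m)"
      using ch by (metis inv_equality nat_pow_closed)
    then have "c [^] m \<in> C \<inter> K"
      using pow_mem[OF C c, of m] pow_mem[OF K h, of m] subgroup.m_inv_closed[OF K] by simp
    then have cm: "c [^] m = \<one>" using CK by auto
    obtain i :: nat where i: "c = g [^] i" using c Cpow by auto
    have "p * m dvd i * m"
      using cm g pow_eq_id[OF g, of "i * m"] by (simp add: i nat_pow_pow ordg m)
    then have "p dvd i" using m0 by simp
    then obtain i' where i': "i = i' * p" by (metis dvdE mult.commute)
    define y where "y = x \<otimes> inv (g [^] i')"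
    have y: "y \<in> carrier G" unfolding y_def using x g by simp
    have gi: "g [^] i' \<in> M" using CM Cpow by auto
    have yM: "y \<notin> M"
    proof
      assume "y \<in> M"
      then have "y \<otimes> g [^] i' \<in> M" using gi subgroup.m_closed[OF M] by auto
      then show False using xM x g by (simp add: y_def m_assoc)
    qed
    have "y [^] p = x [^] p \<otimes> inv (g [^] i)"
      unfolding y_def using x g i' by (simp add: nat_pow_distrib nat_pow_inv[symmetric] nat_pow_pow)
    then have yp: "y [^] p = h" using xp ch g unfolding i[symmetric]
      by (simp add: m_comm[of c h] m_assoc)
    define K' where "K' = K <#> generate G {y}"
    have gy: "subgroup (generate G {y}) G" using y by (simp add: generate_is_subgroup)
    have K': "subgroup K' G" unfolding K'_def by (rule mult_subgroups[OF K gy])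
    have KK': "K \<subseteq> K'"
      using subgroup.one_closed[OF gy] subgroup.mem_carrier[OF K] by (force simp: K'_def set_mult_def)
    have yK': "y \<in> K'"
      using subgroup.one_closed[OF K] y generate.incl[of y "{y}" G] by (force simp: K'_def set_mult_def)
    have "a = \<one>" if a: "a \<in> C" "a \<in> K'" for a
    proof -
      obtain h' and r :: nat where h': "h' \<in> K" and ar: "a = h' \<otimes> y [^] r"
        using a(2) unfolding K'_def set_mult_def generate_pow_on_finite_carrier[OF fin y] by auto
      have ca: "h' \<in> carrier G" "a \<in> carrier G"
        using h' a subgroup.mem_carrier[OF C] subgroup.mem_carrier[OF K] by auto
      have "y [^] r = inv h' \<otimes> a" using ar ca y by (simp add: m_assoc[symmetric])
      then have yr: "y [^] r \<in> M"
        using subgroup.m_closed[OF M] KM CM h' a subgroup.m_inv_closed[OF K]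
        by (metis subsetD)
      \<comment> \<open>Both y^r and y^p = h lie in \<open>M\<close>; if \<open>r\<close> were prime
        to \<open>p\<close>, a Bezout relation would put \<open>y\<close> itself into
        \<open>M\<close>. Once \<open>p\<close> divides \<open>r\<close>, the power y^r is a power
        of \<open>h\<close>, and \<open>a\<close> falls into \<open>K\<close>.\<close>
      have "p dvd r"
      proof (rule ccontr)
        assume "\<not> p dvd r"
        then have cop: "coprime r p" using p by (simp add: prime_imp_coprime coprime_commute)
        obtain s t where st: "r * s = p * t + 1"
          using coprime_bezout_strong[OF cop] p by (metis not_prime_1)
        have "(y [^] r) [^] s = (y [^] p) [^] t \<otimes> y"
          using y by (simp add: nat_pow_pow st nat_pow_Suc)
        then have "y = inv ((y [^] p) [^] t) \<otimes> (y [^] r) [^] s"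
          using y by (simp add: m_assoc[symmetric])
        moreover have "(y [^] p) [^] t \<in> M" using pow_mem[OF M] yp h KM by auto
        ultimately show False
          using yM pow_mem[OF M yr] subgroup.m_closed[OF M] subgroup.m_inv_closed[OF M] by metis
      qed
      then obtain r' where "r = p * r'" by auto
      then have "y [^] r = h [^] r'" using y yp by (simp add: nat_pow_pow[symmetric])
      then have "a \<in> K" using ar h' pow_mem[OF K h] subgroup.m_closed[OF K] by simp
      then show ?thesis using a CK by auto
    qed
    then have "C \<inter> K' = {\<one>}"
      using subgroup.one_closed[OF C] subgroup.one_closed[OF K'] by blast
    then have "K' \<in> F"
      unfolding F_def using K' by simp
    then have "card K' \<le> card K" unfolding Kmax using finF by simp
    moreover have "card K < card K'"
      using KK' yK' yM KM finite_subset[OF subgroup.subset[OF K'] fin]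
      by (metis psubsetI psubset_card_mono subsetD)
    ultimately show False by simp
  qed
  then show thesis using that[of g K] g K CK expo unfolding M_def C_def ordg by auto
qed


section \<open>Character groups\<close>

text \<open>Nonvanishing stands for values in the unit group of the complex numbers. Extensionality
  makes characters equal as functions as soon as they agree on the carrier, so that
  \<open>card\<close> counts them correctly.\<close>

definition char_group :: "('a, 'b) monoid_scheme \<Rightarrow> ('a \<Rightarrow> complex) monoid" where
  "char_group G = \<lparr>carrier = {\<chi> \<in> extensional (carrier G). (\<forall>x\<in>carrier G. \<chi> x \<noteq> 0) \<and>
      (\<forall>x\<in>carrier G. \<forall>y\<in>carrier G. \<chi> (x \<otimes>\<^bsub>G\<^esub> y) = \<chi> x * \<chi> y)},
    monoid.mult = (\<lambda>\<chi> \<psi>. \<lambda>x\<in>carrier G. \<chi> x * \<psi> x), one = (\<lambda>x\<in>carrier G. 1)\<rparr>"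

lemma mult_char_group [simp]: "\<chi> \<otimes>\<^bsub>char_group G\<^esub> \<psi> = (\<lambda>x\<in>carrier G. \<chi> x * \<psi> x)"
  and one_char_group [simp]: "\<one>\<^bsub>char_group G\<^esub> = (\<lambda>x\<in>carrier G. 1)"
  by (simp_all add: char_group_def)

lemma carrier_char_group:
  "\<chi> \<in> carrier (char_group G) \<longleftrightarrow> \<chi> \<in> extensional (carrier G) \<and> (\<forall>x\<in>carrier G. \<chi> x \<noteq> 0) \<and>
     (\<forall>x\<in>carrier G. \<forall>y\<in>carrier G. \<chi> (x \<otimes>\<^bsub>G\<^esub> y) = \<chi> x * \<chi> y)"
  by (simp add: char_group_def)

lemma char_group_mult:
  "\<chi> \<in> carrier (char_group G) \<Longrightarrow> x \<in> carrier G \<Longrightarrow> y \<in> carrier G \<Longrightarrow> \<chi> (x \<otimes>\<^bsub>G\<^esub> y) = \<chi> x * \<chi> y"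
  by (simp add: carrier_char_group)

lemma char_group_one:
  assumes "\<chi> \<in> carrier (char_group G)" "group G"
  shows "\<chi> \<one>\<^bsub>G\<^esub> = 1"
proof -
  interpret group G by fact
  have "\<chi> \<one>\<^bsub>G\<^esub> = \<chi> \<one>\<^bsub>G\<^esub> * \<chi> \<one>\<^bsub>G\<^esub>"
    using char_group_mult[OF assms(1), of "\<one>\<^bsub>G\<^esub>" "\<one>\<^bsub>G\<^esub>"] by simp
  then show ?thesis
    using assms(1) by (simp add: carrier_char_group)
qed

lemma char_group_ext:
  assumes "\<chi> \<in> carrier (char_group G)" "\<psi> \<in> carrier (char_group G)"
    "\<And>x. x \<in> carrier G \<Longrightarrow> \<chi> x = \<psi> x"
  shows "\<chi> = \<psi>"
  using assms by (auto simp: carrier_char_group intro: extensionalityI)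

lemma comm_group_char_group:
  assumes "group G"
  shows "comm_group (char_group G)"
proof -
  interpret group G by fact
  show ?thesis
  proof (rule comm_groupI)
    fix \<chi> assume c: "\<chi> \<in> carrier (char_group G)"
    show "\<one>\<^bsub>char_group G\<^esub> \<otimes>\<^bsub>char_group G\<^esub> \<chi> = \<chi>"
      using c by (auto simp: carrier_char_group extensional_def fun_eq_iff)
    show "\<exists>\<psi>\<in>carrier (char_group G). \<psi> \<otimes>\<^bsub>char_group G\<^esub> \<chi> = \<one>\<^bsub>char_group G\<^esub>"
      using c by (intro bexI[of _ "\<lambda>x\<in>carrier G. inverse (\<chi> x)"])
        (auto simp: carrier_char_group fun_eq_iff restrict_def extensional_def)
  qed (auto simp: carrier_char_group fun_eq_iff restrict_def extensional_def)
qed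

lemma char_group_hom:
  assumes h: "h \<in> hom G H" and "group G"
  shows "(\<lambda>\<chi>. compose (carrier G) \<chi> h) \<in> hom (char_group H) (char_group G)"
proof -
  interpret group G by fact
  show ?thesis
    by (rule homI) (use hom_in_carrier[OF h] hom_mult[OF h] in
      \<open>auto simp: carrier_char_group compose_def fun_eq_iff\<close>)
qed

lemma char_group_iso:
  assumes h: "h \<in> iso G H" and G: "group G" and H: "group H"
  shows "(\<lambda>\<chi>. compose (carrier G) \<chi> h) \<in> iso (char_group H) (char_group G)"
proof -
  define h' where "h' = inv_into (carrier G) h"
  have bij: "bij_betw h (carrier G) (carrier H)" using h by (simp add: iso_def)
  have h': "h' \<in> iso H G" unfolding h'_def by (rule group.iso_set_sym[OF G h])
  have hh: "h \<in> hom G H" "h' \<in> hom H G" using h h' by (auto simp: iso_def)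
  note m = char_group_hom[OF hh(1) G] char_group_hom[OF hh(2) H]
  have 1: "h' (h x) = x" if "x \<in> carrier G" for x
    unfolding h'_def using bij that by (simp add: bij_betw_inv_into_left)
  have 2: "h (h' x) = x" if "x \<in> carrier H" for x
    unfolding h'_def using bij that by (simp add: bij_betw_inv_into_right)
  have "bij_betw (\<lambda>\<chi>. compose (carrier G) \<chi> h) (carrier (char_group H)) (carrier (char_group G))"
  proof (rule bij_betw_byWitness[where f' = "\<lambda>\<chi>. compose (carrier H) \<chi> h'"])
    show "\<forall>\<chi>\<in>carrier (char_group H). compose (carrier H) (compose (carrier G) \<chi> h) h' = \<chi>"
      using 2 hom_in_carrier[OF hh(2)]
      by (auto simp: carrier_char_group compose_def fun_eq_iff extensional_def)
    show "\<forall>\<chi>\<in>carrier (char_group G). compose (carrier G) (compose (carrier H) \<chi> h') h = \<chi>"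
      using 1 hom_in_carrier[OF hh(1)]
      by (auto simp: carrier_char_group compose_def fun_eq_iff extensional_def)
  qed (use m in \<open>auto simp: hom_def\<close>)
  then show ?thesis using m(1) by (simp add: iso_def)
qed

lemma char_group_cong: "G \<cong> H \<Longrightarrow> group G \<Longrightarrow> group H \<Longrightarrow> char_group G \<cong> char_group H"
  using char_group_iso[of _ G H] group.iso_sym[OF comm_group.axioms(2)[OF comm_group_char_group[of H]]]
  by (auto simp: is_iso_def)

text \<open>Since (x, y) = (x, 1)(1, y), a character of the product is the product of its
  restrictions to the two factors; \<open>f'\<close> takes these restrictions.\<close>

lemma char_group_DirProd:
  assumes G: "group G" and H: "group H"
  shows "char_group G \<times>\<times> char_group H \<cong> char_group (G \<times>\<times> H)"
proof -
  interpret G: group G by fact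
  interpret H: group H by fact
  define f where "f = (\<lambda>(\<chi>, \<psi>). \<lambda>(x, y)\<in>carrier (G \<times>\<times> H). \<chi> x * \<psi> y :: complex)"
  define f' where "f' \<xi> = (\<lambda>x\<in>carrier G. \<xi> (x, \<one>\<^bsub>H\<^esub>), \<lambda>y\<in>carrier H. \<xi> (\<one>\<^bsub>G\<^esub>, y) :: complex)" for \<xi>
  have "f \<in> hom (char_group G \<times>\<times> char_group H) (char_group (G \<times>\<times> H))"
    by (rule homI) (auto simp: f_def carrier_char_group fun_eq_iff)
  moreover have "bij_betw f (carrier (char_group G \<times>\<times> char_group H)) (carrier (char_group (G \<times>\<times> H)))"
  proof (rule bij_betw_byWitness[where f' = f'])
    show "\<forall>c\<in>carrier (char_group G \<times>\<times> char_group H). f' (f c) = c"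
      using char_group_one[OF _ G] char_group_one[OF _ H]
      by (auto simp: f_def f'_def fun_eq_iff carrier_char_group extensional_def)
    show "f ` carrier (char_group G \<times>\<times> char_group H) \<subseteq> carrier (char_group (G \<times>\<times> H))"
      using \<open>f \<in> hom _ _\<close> by (auto simp: hom_def)
    have mult: "\<xi> (x, y) = \<xi> (x, \<one>\<^bsub>H\<^esub>) * \<xi> (\<one>\<^bsub>G\<^esub>, y)"
      if "\<xi> \<in> carrier (char_group (G \<times>\<times> H))" "x \<in> carrier G" "y \<in> carrier H" for \<xi> x y
      using char_group_mult[OF that(1), of "(x, \<one>\<^bsub>H\<^esub>)" "(\<one>\<^bsub>G\<^esub>, y)"] that by simp
    then show "\<forall>c\<in>carrier (char_group (G \<times>\<times> H)). f (f' c) = c"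
      by (auto simp: f_def f'_def fun_eq_iff carrier_char_group extensional_def)
    show "f' ` carrier (char_group (G \<times>\<times> H)) \<subseteq> carrier (char_group G \<times>\<times> char_group H)"
    proof
      fix c assume "c \<in> f' ` carrier (char_group (G \<times>\<times> H))"
      then obtain \<xi> where \<xi>: "\<xi> \<in> carrier (char_group (G \<times>\<times> H))" and c: "c = f' \<xi>" by auto
      have "\<xi> (x \<otimes>\<^bsub>G\<^esub> x', \<one>\<^bsub>H\<^esub>) = \<xi> (x, \<one>\<^bsub>H\<^esub>) * \<xi> (x', \<one>\<^bsub>H\<^esub>)"
        if "x \<in> carrier G" "x' \<in> carrier G" for x x'
        using char_group_mult[OF \<xi>, of "(x, \<one>\<^bsub>H\<^esub>)" "(x', \<one>\<^bsub>H\<^esub>)"] that by simp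
      moreover have "\<xi> (\<one>\<^bsub>G\<^esub>, y \<otimes>\<^bsub>H\<^esub> y') = \<xi> (\<one>\<^bsub>G\<^esub>, y) * \<xi> (\<one>\<^bsub>G\<^esub>, y')"
        if "y \<in> carrier H" "y' \<in> carrier H" for y y'
        using char_group_mult[OF \<xi>, of "(\<one>\<^bsub>G\<^esub>, y)" "(\<one>\<^bsub>G\<^esub>, y')"] that by simp
      ultimately show "c \<in> carrier (char_group G \<times>\<times> char_group H)"
        using \<xi> by (auto simp: c f'_def carrier_char_group)
    qed
  qed
  ultimately show ?thesis by (auto simp: is_iso_def iso_def)
qed

section \<open>Self-duality of cyclic groups and of abelian p-groups\<close>

lemma char_group_integer_mod_group:
  assumes n: "n > 0"
  shows "integer_mod_group n \<cong> char_group (integer_mod_group n)"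
proof -
  define w where "w = cis (2 * pi / real n)"
  have w0: "w \<noteq> 0" unfolding w_def by simp
  have wn: "w ^ n = 1" using n unfolding w_def by (simp add: DeMoivre)
  have wmod: "w powi (a mod int n) = w powi a" for a
  proof -
    have "w powi a = w powi (int n * (a div int n) + a mod int n)" by simp
    also have "\<dots> = (w powi int n) powi (a div int n) * w powi (a mod int n)"
      using w0 by (simp only: power_int_add power_int_mult simp_thms)
    finally show ?thesis using wn by simp
  qed
  have wcis: "w powi int i = cis (2 * pi * real i / real n)" for i
    by (simp add: w_def DeMoivre mult.commute)
  \<comment> \<open>The powers of \<open>w\<close> run through all n-th roots of unity exactly once.
    A character of a cyclic group is determined by its value at a generator, which can be any such
    root.\<close>
  have roots: "bij_betw (\<lambda>k. w powi int k) {..<n} {z. z ^ n = 1}"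
    unfolding wcis by (rule bij_betw_roots_unity[OF n])
  let ?Z = "integer_mod_group n"
  have car: "carrier ?Z = {0..<int n}" using n by (simp add: carrier_integer_mod_group)
  \<comment> \<open>The generator is written 1 mod n because for n = 1 the carrier is {0} and does
    not contain 1.\<close>
  define u where "u = 1 mod int n"
  have u: "u \<in> carrier ?Z" using n by (simp add: car u_def)
  define f where "f k = (\<lambda>m\<in>carrier ?Z. w powi (k * m))" for k
  have "f \<in> hom ?Z (char_group ?Z)"
  proof (rule homI)
    fix k assume "k \<in> carrier ?Z"
    have "w powi (k * ((x + y) mod int n)) = w powi (k * x) * w powi (k * y)" for x y
      using w0 by (metis wmod mod_mult_right_eq distrib_left power_int_add)
    moreover have "(x + y) mod int n \<in> carrier ?Z" for x y using n by (simp add: car)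
    ultimately show "f k \<in> carrier (char_group ?Z)" using w0 by (auto simp: carrier_char_group f_def)
  next
    fix k l
    have "w powi ((k + l) mod int n * m) = w powi (k * m) * w powi (l * m)" for m
      using w0 by (metis wmod mod_mult_left_eq distrib_right power_int_add)
    then show "f (k \<otimes>\<^bsub>?Z\<^esub> l) = f k \<otimes>\<^bsub>char_group ?Z\<^esub> f l"
      by (auto simp: f_def fun_eq_iff)
  qed
  have fu: "f k u = w powi k" for k
    unfolding f_def using u by simp (metis u_def wmod mod_mult_right_eq mult_1_right)
  have "inj_on f (carrier ?Z)"
  proof (rule inj_onI)
    fix k l assume kl: "k \<in> carrier ?Z" "l \<in> carrier ?Z" "f k = f l"
    then have "w powi int (nat k) = w powi int (nat l)" by (simp add: car flip: fu)
    moreover have "nat k \<in> {..<n}" "nat l \<in> {..<n}" using kl by (auto simp: car)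
    ultimately have "nat k = nat l" using roots unfolding bij_betw_def inj_on_def by blast
    then show "k = l" using kl(1,2) by (simp add: car eq_nat_nat_iff)
  qed
  moreover have "carrier (char_group ?Z) \<subseteq> f ` carrier ?Z"
  proof
    fix \<chi> assume \<chi>: "\<chi> \<in> carrier (char_group ?Z)"
    have pow: "\<chi> (int m mod int n) = \<chi> u ^ m" for m
    proof (induction m)
      case 0
      then show ?case using char_group_one[OF \<chi>] by simp
    next
      case (Suc m)
      have "int m mod int n \<in> carrier ?Z" using n by (simp add: car)
      from char_group_mult[OF \<chi> u this] show ?case
        by (simp add: u_def mod_add_eq Suc.IH)
    qed
    have "\<chi> u ^ n = 1" using pow[of n] char_group_one[OF \<chi>] by simp
    then obtain k where k: "k < n" "\<chi> u = w powi int k"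
      using roots by (auto simp: bij_betw_def image_iff set_eq_iff)
    have "\<chi> m = w powi (int k * m)" if m: "m \<in> carrier ?Z" for m
    proof -
      have "\<chi> m = \<chi> u ^ nat m" using pow[of "nat m"] m by (simp add: car)
      then show ?thesis using m by (simp add: k(2) car power_int_mult flip: power_int_of_nat)
    qed
    then have "\<chi> = f (int k)"
      using \<chi> by (auto simp: f_def fun_eq_iff carrier_char_group extensional_def)
    then show "\<chi> \<in> f ` carrier ?Z" using k by (auto simp: car)
  qed
  ultimately have "f \<in> iso ?Z (char_group ?Z)"
    using \<open>f \<in> hom _ _\<close> by (auto simp: iso_iff hom_def)
  then show ?thesis by (auto simp: is_iso_def)
qed

lemma (in group) integer_mod_group_iso_generated:
  assumes "g \<in> carrier G" "ord g > 0"
  shows "integer_mod_group (ord g) \<cong> subgroup_generated G {g}"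
proof -
  let ?Z = "integer_mod_group (ord g)"
  have car: "carrier ?Z = {0..<int (ord g)}" using assms(2) by (simp add: carrier_integer_mod_group)
  have modpow: "g [^] (i mod int (ord g)) = g [^] i" for i
    using assms(1) by (simp add: int_pow_eq minus_mod_eq_mult_div)
  have im: "carrier (subgroup_generated G {g}) = range (\<lambda>i::int. g [^] i)"
    by (rule carrier_subgroup_generated_by_singleton[OF assms(1)])
  have "(\<lambda>i. g [^] i) \<in> hom ?Z (subgroup_generated G {g})"
    by (rule homI) (auto simp: im modpow int_pow_mult assms(1))
  moreover have "range (\<lambda>i::int. g [^] i) \<subseteq> (\<lambda>i. g [^] i) ` carrier ?Z"
  proof (rule image_subsetI)
    fix i :: int
    have "i mod int (ord g) \<in> carrier ?Z" using assms(2) by (simp add: car)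
    then show "g [^] i \<in> (\<lambda>i. g [^] i) ` carrier ?Z" using modpow[of i] by (metis image_eqI)
  qed
  moreover have "inj_on (\<lambda>i::int. g [^] i) (carrier ?Z)"
  proof (rule inj_onI)
    fix i j :: int assume ij: "i \<in> carrier ?Z" "j \<in> carrier ?Z" "g [^] i = g [^] j"
    then have "i mod int (ord g) = j mod int (ord g)"
      using assms(1) by (simp add: int_pow_eq mod_eq_dvd_iff dvd_diff_commute)
    then show "i = j" using ij by (simp add: car)
  qed
  ultimately have "(\<lambda>i. g [^] i) \<in> iso ?Z (subgroup_generated G {g})"
    by (auto simp: iso_iff im)
  then show ?thesis by (auto simp: is_iso_def)
qed

lemma (in group) char_group_iso_generated:
  assumes "g \<in> carrier G" "ord g > 0"
  shows "char_group (subgroup_generated G {g}) \<cong> subgroup_generated G {g}"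
proof -
  let ?C = "subgroup_generated G {g}" and ?Z = "integer_mod_group (ord g)"
  have Z: "?Z \<cong> ?C" by (rule integer_mod_group_iso_generated[OF assms])
  have "?C \<cong> ?Z" by (rule group.iso_sym[OF group_integer_mod_group Z])
  moreover have "?Z \<cong> char_group ?Z" by (rule char_group_integer_mod_group[OF assms(2)])
  moreover have "char_group ?Z \<cong> char_group ?C" by (rule char_group_cong[OF Z]) auto
  ultimately have "?C \<cong> char_group ?C" by (metis iso_trans)
  then show ?thesis by (rule group.iso_sym[rotated]) simp
qed

text \<open>Duality respects direct products and fixes cyclic groups up to isomorphism. So it
  suffices to split off one cyclic factor and to apply the induction hypothesis to the complement
  \<open>K\<close>, whose order is a smaller power of \<open>p\<close>.\<close>

theorem char_group_self_dual:
  fixes G :: "('a, 'b) monoid_scheme" and p k :: nat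
  assumes "Factorial_Ring.prime p" "comm_group G" "finite (carrier G)" "order G = p ^ k"
  shows "char_group G \<cong> G"
  using assms(2-)
proof (induction k arbitrary: G rule: less_induct)
  case (less k)
  interpret comm_group G by fact
  obtain g K where g: "g \<in> carrier G" and K: "subgroup K G" and gK: "generate G {g} \<inter> K = {\<one>\<^bsub>G\<^esub>}"
    "generate G {g} <#>\<^bsub>G\<^esub> K = carrier G" "\<And>x. x \<in> carrier G \<Longrightarrow> x [^]\<^bsub>G\<^esub> ord g = \<one>\<^bsub>G\<^esub>"
    using primary_cyclic_complement[OF assms(1) less.prems(2,3)] by metis
  have ordg: "ord g > 0" using ord_ge_1[OF less.prems(2) g] by simp
  let ?C = "subgroup_generated G {g}" and ?K = "subgroup_generated G K"
  have C: "subgroup (generate G {g}) G" using g by (simp add: generate_is_subgroup)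
  have CC: "subgroup_generated G (generate G {g}) = ?C"
    using g subgroup.carrier_subgroup_generated_subgroup[OF C]
    by (simp add: subgroup_generated_def)
  have carK: "carrier ?K = K" using K by (rule subgroup.carrier_subgroup_generated_subgroup)
  interpret group_disjoint_sum G "generate G {g}" K
    using C K by (simp add: group_disjoint_sum_def)
  have prod: "?C \<times>\<times> ?K \<cong> G"
    using iso_group_mul[OF less.prems(1)] gK unfolding CC is_iso_def by auto
  have charC: "char_group ?C \<cong> ?C" by (rule char_group_iso_generated[OF g ordg])
  show ?case
  \<comment> \<open>If \<open>K\<close> is everything, the order does not drop. Then
    \<open>g\<close> lies in the trivial intersection, the exponent \<open>ord g\<close> is 1 and
    \<open>G\<close> is trivial, hence equal to its own cyclic factor.\<close>
  proof (cases "K = carrier G")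
    case True
    then have "g \<in> generate G {g} \<inter> K" using g by (simp add: generate.incl)
    then have "g = \<one>\<^bsub>G\<^esub>" unfolding gK(1) by simp
    then have "x = \<one>\<^bsub>G\<^esub>" if "x \<in> carrier G" for x
      using gK(3)[OF that] that by simp
    then have "carrier G = {\<one>\<^bsub>G\<^esub>}" by blast
    then have "?C = G"
      using \<open>g = _\<close> subgroup_generated_group_carrier by simp
    then show ?thesis using charC by simp
  next
    case False
    have "card K < card (carrier G)"
      using False subgroup.subset[OF K] less.prems(2) by (intro psubset_card_mono) auto
    moreover have "card K dvd p ^ k"
      using lagrange[OF K] less.prems(3) by (metis dvd_triv_right)
    then obtain j where j: "card K = p ^ j"
      using assms(1) by (auto simp: divides_primepow_nat)
    ultimately have "j < k"
      using less.prems(3) assms(1) by (metis order_def power_less_imp_less_exp prime_gt_1_nat)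
    then have "char_group ?K \<cong> ?K"
      using less.IH[of j ?K] j carK abelian_subgroup_generated[OF less.prems(1)] less.prems(2)
        finite_subset[OF subgroup.subset[OF K]] by (simp add: order_def)
    then have "char_group ?C \<times>\<times> char_group ?K \<cong> ?C \<times>\<times> ?K"
      using charC group.DirProd_iso_trans[OF comm_group.axioms(2)[OF comm_group_char_group[of ?C]]]
      by simp
    moreover have "char_group G \<cong> char_group (?C \<times>\<times> ?K)"
      using char_group_cong[OF group.iso_sym[OF _ prod]] DirProd_group[of ?C ?K] by simp
    moreover have "char_group (?C \<times>\<times> ?K) \<cong> char_group ?C \<times>\<times> char_group ?K"
      by (intro group.iso_sym[OF _ char_group_DirProd] DirProd_group
          comm_group.axioms(2)[OF comm_group_char_group]) auto
    ultimately show ?thesis using prod by (metis iso_trans)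
  qed
qed


section \<open>Subgroup duality\<close>

lemma (in group) subgroup_relative_iff:
  assumes "subgroup K G"
  shows "subgroup H (G\<lparr>carrier := K\<rparr>) \<longleftrightarrow> subgroup H G \<and> H \<subseteq> K"
  using incl_subgroup[OF assms] subgroup_incl[OF _ assms] subgroup.subset[of H "G\<lparr>carrier := K\<rparr>"]
  by auto

lemma (in comm_group) comm_group_subgroup:
  assumes "subgroup K G"
  shows "comm_group (G\<lparr>carrier := K\<rparr>)"
  by (intro group.group_comm_groupI subgroup_imp_group assms)
    (auto intro: m_comm subgroup.mem_carrier[OF assms])

text \<open>Characters that are trivial on \<open>H\<close> are the characters of the quotient by
  \<open>H\<close>, pulled back along the projection. The quotient is again an abelian p-group, so
  by self-duality it has as many characters as elements.\<close>

lemma (in comm_group) card_annihilator: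
  fixes p k :: nat
  assumes p: "Factorial_Ring.prime p" and fin: "finite (carrier G)" and ordG: "order G = p ^ k"
    and H: "subgroup H G"
  shows "card {\<chi> \<in> carrier (char_group G). \<forall>h\<in>H. \<chi> h = 1} * card H = order G"
proof -
  interpret H: normal H G by (rule subgroup_imp_normal[OF H])
  let ?Q = "G Mod H"
  have carQ: "carrier ?Q = rcosets H" by (simp add: FactGroup_def)
  have finQ: "finite (carrier ?Q)" unfolding carrier_FactGroup using fin by simp
  have "order ?Q dvd p ^ k" using lagrange[OF H] by (metis carQ dvd_triv_left order_def ordG)
  then obtain j where "order ?Q = p ^ j" using p by (auto simp: divides_primepow_nat)
  then have "char_group ?Q \<cong> ?Q"
    using char_group_self_dual[OF p _ finQ] abelian_FactGroup[OF H] by blast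
  then have card_char: "card (carrier (char_group ?Q)) = card (rcosets H)"
    unfolding carQ[symmetric] by (rule iso_same_card)
  define f where "f \<chi> = (\<lambda>x\<in>carrier G. \<chi> (H #> x) :: complex)" for \<chi>
  have cosQ: "H #> x \<in> carrier ?Q" if "x \<in> carrier G" for x
    using that by (auto simp: carrier_FactGroup)
  have "bij_betw f (carrier (char_group ?Q)) {\<chi> \<in> carrier (char_group G). \<forall>h\<in>H. \<chi> h = 1}"
    (is "bij_betw f _ ?Ann")
    unfolding bij_betw_def
  proof
    show "inj_on f (carrier (char_group ?Q))"
    proof (rule inj_onI, rule char_group_ext)
      fix \<chi> \<psi> U assume "f \<chi> = f \<psi>" "U \<in> carrier ?Q"
      then obtain x where "x \<in> carrier G" "U = H #> x" by (auto simp: carrier_FactGroup)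
      then show "\<chi> U = \<psi> U" using \<open>f \<chi> = f \<psi>\<close> by (metis f_def restrict_apply')
    qed
    show "f ` carrier (char_group ?Q) = ?Ann"
    proof
      show "f ` carrier (char_group ?Q) \<subseteq> ?Ann"
      proof
        fix \<psi> assume "\<psi> \<in> f ` carrier (char_group ?Q)"
        then obtain \<chi> where \<chi>: "\<chi> \<in> carrier (char_group ?Q)" and \<psi>: "\<psi> = f \<chi>" by auto
        have "\<chi> (H #> (x \<otimes> y)) = \<chi> (H #> x) * \<chi> (H #> y)"
          if "x \<in> carrier G" "y \<in> carrier G" for x y
          using char_group_mult[OF \<chi> cosQ cosQ, OF that] that by (simp add: H.rcos_sum)
        moreover have "\<chi> (H #> h) = 1" if "h \<in> H" for h
          using char_group_one[OF \<chi> H.factorgroup_is_group] H.rcos_const[OF is_group that] by simp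
        ultimately show "\<psi> \<in> ?Ann"
          using \<chi> cosQ H.subset unfolding \<psi> f_def by (auto simp: carrier_char_group)
      qed
      show "?Ann \<subseteq> f ` carrier (char_group ?Q)"
      proof
        fix \<psi> assume "\<psi> \<in> ?Ann"
        then have \<psi>: "\<psi> \<in> carrier (char_group G)" and triv: "\<And>h. h \<in> H \<Longrightarrow> \<psi> h = 1" by auto
        have "\<psi> x = \<psi> y" if xy: "x \<in> carrier G" "y \<in> carrier G" "H #> x = H #> y" for x y
        proof -
          have "x \<in> H #> y" using rcos_self[OF xy(1) H] xy(3) by simp
          then obtain h where h: "h \<in> H" "x = h \<otimes> y" by (auto simp: r_coset_def)
          then show ?thesis
            using char_group_mult[OF \<psi>, of h y] triv H.subset xy by auto
        qed
        \<comment> \<open>Constancy on cosets lets \<open>\<psi>\<close> descend to the quotient;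
          restricting the descended map to the carrier makes it extensional.\<close>
        then obtain g where g: "\<And>x. x \<in> carrier G \<Longrightarrow> \<psi> x = g (H #> x)"
          using function_factors_left_gen[of "\<lambda>x. x \<in> carrier G" "(#>) H" \<psi>] by blast
        define \<chi> where "\<chi> = restrict g (carrier ?Q)"
        have \<chi>c: "\<chi> (H #> x) = \<psi> x" if "x \<in> carrier G" for x
          using that cosQ g by (simp add: \<chi>_def)
        have "\<chi> U \<noteq> 0" if "U \<in> carrier ?Q" for U
          using that \<psi> \<chi>c by (auto simp: carrier_FactGroup carrier_char_group)
        moreover have "\<chi> (U <#> V) = \<chi> U * \<chi> V" if "U \<in> carrier ?Q" "V \<in> carrier ?Q" for U V
          using that \<chi>c char_group_mult[OF \<psi>] by (auto simp: carrier_FactGroup H.rcos_sum)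
        ultimately have "\<chi> \<in> carrier (char_group ?Q)"
          by (simp add: carrier_char_group) (simp add: \<chi>_def)
        moreover have "f \<chi> = \<psi>"
          using \<psi> \<chi>c by (auto simp: f_def fun_eq_iff carrier_char_group extensional_def)
        ultimately show "\<psi> \<in> f ` carrier (char_group ?Q)" by auto
      qed
    qed
  qed
  then have "card ?Ann = card (rcosets H)" using card_char by (simp add: bij_betw_same_card)
  then show ?thesis using lagrange[OF H] by simp
qed

text \<open>The isomorphism \<open>\<theta>\<close> is read as a pairing of \<open>G\<close> with
  itself, multiplicative in both arguments. It need not be symmetric, so the inverse of the left
  annihilator \<open>L\<close> is sought as the right annihilator \<open>R\<close>.\<close>

theorem (in comm_group) subgroup_duality:
  fixes p k :: nat
  assumes p: "Factorial_Ring.prime p" and fin: "finite (carrier G)" and ordG: "order G = p ^ k"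
  obtains L where "bij_betw L {H. subgroup H G} {H. subgroup H G}"
    "\<And>H. subgroup H G \<Longrightarrow> G Mod H \<cong> G\<lparr>carrier := L H\<rparr>"
proof -
  have "G \<cong> char_group G"
    using char_group_self_dual[OF p comm_group_axioms fin ordG]
      comm_group.axioms(2)[OF comm_group_char_group[OF is_group]] group.iso_sym by blast
  then obtain \<theta> where \<theta>: "\<theta> \<in> iso G (char_group G)" by (auto simp: is_iso_def)
  have \<theta>bij: "bij_betw \<theta> (carrier G) (carrier (char_group G))" using \<theta> by (simp add: iso_def)
  have \<theta>c: "\<theta> x \<in> carrier (char_group G)" if "x \<in> carrier G" for x
    using \<theta>bij that by (auto simp: bij_betw_def)
  have \<theta>l: "\<theta> (x \<otimes> y) z = \<theta> x z * \<theta> y z"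
    if "x \<in> carrier G" "y \<in> carrier G" "z \<in> carrier G" for x y z
    using \<theta> that by (auto simp: iso_def hom_def)
  have \<theta>r: "\<theta> x (y \<otimes> z) = \<theta> x y * \<theta> x z"
    if "x \<in> carrier G" "y \<in> carrier G" "z \<in> carrier G" for x y z
    using char_group_mult[OF \<theta>c] that by auto
  have \<theta>0: "\<theta> x y \<noteq> 0" if "x \<in> carrier G" "y \<in> carrier G" for x y
    using \<theta>c[OF that(1)] that(2) by (auto simp: carrier_char_group)
  have \<theta>1r: "\<theta> x \<one> = 1" if "x \<in> carrier G" for x
    using char_group_one[OF \<theta>c[OF that] is_group] .
  have \<theta>1l: "\<theta> \<one> y = 1" if "y \<in> carrier G" for y
    using \<theta>l[of \<one> \<one> y] \<theta>0[of \<one> y] that by simp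
  have \<theta>il: "\<theta> (inv x) y = inverse (\<theta> x y)" if "x \<in> carrier G" "y \<in> carrier G" for x y
    using \<theta>l[of "inv x" x y] that \<theta>1l[of y] \<theta>0[of x y] by (simp add: field_simps)
  have \<theta>ir: "\<theta> x (inv y) = inverse (\<theta> x y)" if "x \<in> carrier G" "y \<in> carrier G" for x y
    using \<theta>r[of x "inv y" y] that \<theta>1r[of x] \<theta>0[of x y] by (simp add: field_simps)
  define L where "L H = {x \<in> carrier G. \<forall>h\<in>H. \<theta> x h = 1}" for H
  define R where "R T = {y \<in> carrier G. \<forall>x\<in>T. \<theta> x y = 1}" for T
  have Lsub: "subgroup (L H) G" if "subgroup H G" for H
    using subgroup.mem_carrier[OF that] \<theta>l \<theta>1l \<theta>il by (intro subgroupI) (auto simp: L_def)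
  have Rsub: "subgroup (R T) G" if "subgroup T G" for T
    using subgroup.mem_carrier[OF that] \<theta>r \<theta>1r \<theta>ir by (intro subgroupI) (auto simp: R_def)
  have finS: "finite H" if "subgroup H G" for H
    using finite_subset[OF subgroup.subset[OF that] fin] .
  have cardpos: "card H > 0" if "subgroup H G" for H
    using finS[OF that] subgroup.one_closed[OF that] by (auto simp: card_gt_0_iff)
  have cardL: "card (L H) * card H = order G" if H: "subgroup H G" for H
  proof -
    have "bij_betw \<theta> (L H) {\<chi> \<in> carrier (char_group G). \<forall>h\<in>H. \<chi> h = 1}"
      using \<theta>bij by (rule bij_betw_subset) (auto simp: L_def bij_betw_imp_surj_on[OF \<theta>bij, symmetric])
    then show ?thesis using card_annihilator[OF p fin ordG H] by (simp add: bij_betw_same_card)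
  qed
  \<comment> \<open>The inclusion of \<open>H\<close> in \<open>R (L H)\<close> is formal. Moreover
    \<open>L H\<close> lies in \<open>L (R (L H))\<close>, and as the product of
    \<open>card (L X)\<close> and \<open>card X\<close> is constant, \<open>R (L H)\<close> has at
    most as many elements as \<open>H\<close>.\<close>
  have RL: "R (L H) = H" if H: "subgroup H G" for H
  proof -
    note LH = Lsub[OF H]
    note RLH = Rsub[OF LH]
    have "L H \<subseteq> L (R (L H))" by (auto simp: L_def R_def)
    then have "card (L H) * card (R (L H)) \<le> card (L (R (L H))) * card (R (L H))"
      by (intro mult_right_mono card_mono finS Lsub[OF RLH]) auto
    also have "\<dots> = card (L H) * card H" using cardL[OF RLH] cardL[OF H] by simp
    finally have "card (R (L H)) \<le> card H" using cardpos[OF LH] by simp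
    moreover have "H \<subseteq> R (L H)" using subgroup.mem_carrier[OF H] by (auto simp: L_def R_def)
    ultimately show ?thesis using card_seteq[OF finS[OF RLH]] by blast
  qed
  have finSub: "finite {H. subgroup H G}"
    by (rule rev_finite_subset[of "Pow (carrier G)"]) (auto simp: fin dest: subgroup.subset)
  have "inj_on L {H. subgroup H G}" by (rule inj_on_inverseI[of _ R]) (simp add: RL)
  then have "bij_betw L {H. subgroup H G} {H. subgroup H G}"
    using endo_inj_surj[OF finSub] Lsub by (auto simp: bij_betw_def)
  moreover have "G Mod H \<cong> G\<lparr>carrier := L H\<rparr>" if H: "subgroup H G" for H
  proof -
    let ?L = "G\<lparr>carrier := L H\<rparr>"
    note LH = Lsub[OF H]
    have Lcar: "x \<in> carrier G" if "x \<in> L H" for x using that by (simp add: L_def)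
    have L: "comm_group ?L" by (rule comm_group_subgroup[OF LH])
    have Lgrp: "group ?L" using L by (simp add: comm_group.axioms(2))
    have "card (L H) dvd p ^ k" using lagrange[OF LH] by (metis dvd_triv_right ordG)
    then obtain j where "order ?L = p ^ j"
      using p by (auto simp: divides_primepow_nat order_def)
    then have dual: "char_group ?L \<cong> ?L"
      using char_group_self_dual[OF p L] finS[OF LH] by simp
    \<comment> \<open>Fixing the second argument gives a homomorphism into the characters of
      \<open>L H\<close>, with kernel \<open>R (L H)\<close>, which is \<open>H\<close>. The
      quotient thus embeds into a group of the same order, and that group is isomorphic to
      \<open>L H\<close>.\<close>
    define r where "r y = (\<lambda>x\<in>L H. \<theta> x y)" for y
    have "r \<in> hom G (char_group ?L)"
      by (rule homI) (use Lcar \<theta>0 \<theta>l \<theta>r subgroup.m_closed[OF LH] in \<open>auto simp: carrier_char_group r_def fun_eq_iff\<close>)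
    then interpret r: group_hom G "char_group ?L" r
      using comm_group_char_group[OF Lgrp]
      by (simp add: group_hom_def group_hom_axioms_def comm_group.axioms(2))
    have ker: "kernel G (char_group ?L) r = H"
      using RL[OF H] by (auto simp: kernel_def R_def r_def fun_eq_iff restrict_def)
    let ?r = "\<lambda>U. the_elem (r ` U)"
    have inj: "inj_on ?r (carrier (G Mod H))" using r.FactGroup_inj_on unfolding ker .
    have hom: "?r \<in> hom (G Mod H) (char_group ?L)" using r.FactGroup_hom unfolding ker .
    have "card (carrier (G Mod H)) * card H = card (L H) * card H"
      using lagrange[OF H] cardL[OF H] by (simp add: FactGroup_def)
    then have "card (carrier (G Mod H)) = card (L H)" using cardpos[OF H] by simp
    also have "\<dots> = card (carrier (char_group ?L))" using iso_same_card[OF dual] by simp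
    finally have "?r ` carrier (G Mod H) = carrier (char_group ?L)"
      using iso_finite[OF dual] finS[OF LH] hom inj
      by (intro card_subset_eq) (auto simp: card_image hom_def)
    then have "?r \<in> iso (G Mod H) (char_group ?L)" using hom inj by (simp add: iso_iff)
    then have "G Mod H \<cong> char_group ?L" by (rule is_isoI)
    then show ?thesis using dual by (rule iso_trans)
  qed
  ultimately show thesis using that by blast
qed

lemma (in comm_group) card_quotients_eq_card_subgroups:
  fixes p k :: nat
  assumes "Factorial_Ring.prime p" "finite (carrier G)" "order G = p ^ k"
  shows "card {H. subgroup H G \<and> G Mod H \<cong> Q} = card {T. subgroup T G \<and> G\<lparr>carrier := T\<rparr> \<cong> Q}"
proof -
  obtain L where L: "bij_betw L {H. subgroup H G} {H. subgroup H G}"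
    and iso: "\<And>H. subgroup H G \<Longrightarrow> G Mod H \<cong> G\<lparr>carrier := L H\<rparr>"
    using subgroup_duality[OF assms] by blast
  have iff: "G Mod H \<cong> Q \<longleftrightarrow> G\<lparr>carrier := L H\<rparr> \<cong> Q" if "subgroup H G" for H
    using iso_trans[OF iso[OF that], of Q] iso_trans[OF group.iso_sym[OF _ iso[OF that]], of Q]
      normal.factorgroup_is_group[OF subgroup_imp_normal[OF that]] by auto
  have "bij_betw L {H. subgroup H G \<and> G Mod H \<cong> Q} {T. subgroup T G \<and> G\<lparr>carrier := T\<rparr> \<cong> Q}"
  proof (rule bij_betw_subset[OF L])
    show "L ` {H. subgroup H G \<and> G Mod H \<cong> Q} = {T. subgroup T G \<and> G\<lparr>carrier := T\<rparr> \<cong> Q}"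
    proof (intro equalityI subsetI)
      fix T assume "T \<in> L ` {H. subgroup H G \<and> G Mod H \<cong> Q}"
      then obtain H where "subgroup H G" "G Mod H \<cong> Q" "T = L H" by auto
      then show "T \<in> {T. subgroup T G \<and> G\<lparr>carrier := T\<rparr> \<cong> Q}"
        using iff bij_betwE[OF L] by simp
    next
      fix T assume "T \<in> {T. subgroup T G \<and> G\<lparr>carrier := T\<rparr> \<cong> Q}"
      moreover from this obtain H where "subgroup H G" "T = L H"
        using bij_betw_imp_surj_on[OF L] by (metis (mono_tags) imageE mem_Collect_eq)
      ultimately show "T \<in> L ` {H. subgroup H G \<and> G Mod H \<cong> Q}" using iff by auto
    qed
  qed auto
  then show ?thesis by (rule bij_betw_same_card)
qed

section \<open>Subgroups above a fixed subgroup, and sections counted by type\<close>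

lemma (in normal) bij_betw_subgroups_FactGroup:
  "bij_betw (\<lambda>K. (#>) H ` K) {K. subgroup K G \<and> H \<subseteq> K} {A. subgroup A (G Mod H)}"
proof (rule bij_betw_byWitness[where f' = Union])
  have cover: "\<Union>((#>) H ` K) = K" if K: "subgroup K G" "H \<subseteq> K" for K
  proof
    show "\<Union>((#>) H ` K) \<subseteq> K"
      using K subgroup.m_closed[OF K(1)] by (auto simp: r_coset_def)
    show "K \<subseteq> \<Union>((#>) H ` K)"
      using subgroup.mem_carrier[OF K(1)] rcos_self[OF _ subgroup_axioms] by blast
  qed
  then show "\<forall>K\<in>{K. subgroup K G \<and> H \<subseteq> K}. \<Union>((#>) H ` K) = K" by blast
  show "\<forall>A\<in>{A. subgroup A (G Mod H)}. (#>) H ` \<Union>A = A"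
  proof clarify
    fix A assume A: "subgroup A (G Mod H)"
    show "(#>) H ` \<Union>A = A"
      using factgroup_subgroup_union_char[OF A] subgroup.subset[OF A]
      by (fastforce simp: carrier_FactGroup)
  qed
  show "(\<lambda>K. (#>) H ` K) ` {K. subgroup K G \<and> H \<subseteq> K} \<subseteq> {A. subgroup A (G Mod H)}"
  proof clarify
    fix K assume K: "subgroup K G" "H \<subseteq> K"
    interpret hom: group_hom G "G Mod H" "(#>) H"
      using r_coset_hom_Mod factorgroup_is_group
      by (simp add: group_hom_def group_hom_axioms_def)
    show "subgroup ((#>) H ` K) (G Mod H)" by (rule hom.subgroup_img_is_subgroup[OF K(1)])
  qed
  show "\<Union> ` {A. subgroup A (G Mod H)} \<subseteq> {K. subgroup K G \<and> H \<subseteq> K}"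
    using factgroup_subgroup_union_subgroup subgroup.one_closed[of _ "G Mod H"] by fastforce
qed

theorem n_sections_eq_sum:
  fixes G :: "('a, 'b) monoid_scheme" and p k :: nat
  assumes p: "Factorial_Ring.prime p" and "comm_group G" and fin: "finite (carrier G)"
    and ordG: "order G = p ^ k"
  shows "n_sections G Q = (\<Sum>T\<in>{T. subgroup T G \<and> G\<lparr>carrier := T\<rparr> \<cong> Q}. card (subgroup_lattice (G Mod T)))"
proof -
  interpret comm_group G by fact
  let ?S = "{K. subgroup K G}" and ?T = "{T. subgroup T G \<and> G\<lparr>carrier := T\<rparr> \<cong> Q}"
  have finS: "finite ?S"
    by (rule rev_finite_subset[of "Pow (carrier G)"]) (auto simp: fin dest: subgroup.subset)
  \<comment> \<open>The sections are fibred over the top \<open>K\<close>, so that duality can be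
    applied inside each \<open>K\<close> separately.\<close>
  have "n_sections G Q = card (SIGMA K:?S. {H. subgroup H (G\<lparr>carrier := K\<rparr>) \<and> G\<lparr>carrier := K\<rparr> Mod H \<cong> Q})"
    unfolding n_sections_def sections_comm[OF comm_group_axioms]
    by (rule bij_betw_same_card[of prod.swap])
      (auto simp: subgroup_relative_iff inj_on_def bij_betw_def image_iff)
  also have "\<dots> = (\<Sum>K\<in>?S. card {H. subgroup H (G\<lparr>carrier := K\<rparr>) \<and> G\<lparr>carrier := K\<rparr> Mod H \<cong> Q})"
    by (rule card_SigmaI[OF finS])
      (auto simp: subgroup_relative_iff intro: finite_subset[OF _ finS])
  also have "\<dots> = (\<Sum>K\<in>?S. card {T. subgroup T (G\<lparr>carrier := K\<rparr>) \<and> G\<lparr>carrier := T\<rparr> \<cong> Q})"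
  proof (rule sum.cong[OF refl])
    fix K assume "K \<in> ?S"
    then have K: "subgroup K G" by simp
    have "card K dvd p ^ k" using lagrange[OF K] by (metis dvd_triv_right ordG)
    then obtain j where "order (G\<lparr>carrier := K\<rparr>) = p ^ j"
      using p by (auto simp: divides_primepow_nat order_def)
    then show "card {H. subgroup H (G\<lparr>carrier := K\<rparr>) \<and> G\<lparr>carrier := K\<rparr> Mod H \<cong> Q} =
        card {T. subgroup T (G\<lparr>carrier := K\<rparr>) \<and> G\<lparr>carrier := T\<rparr> \<cong> Q}"
      using comm_group.card_quotients_eq_card_subgroups[OF comm_group_subgroup[OF K] p _ \<open>order _ = p ^ j\<close>]
        finite_subset[OF subgroup.subset[OF K] fin] by simp
  qed
  also have "\<dots> = card (SIGMA K:?S. {T. subgroup T (G\<lparr>carrier := K\<rparr>) \<and> G\<lparr>carrier := T\<rparr> \<cong> Q})"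
    by (rule card_SigmaI[symmetric, OF finS])
      (auto simp: subgroup_relative_iff intro: finite_subset[OF _ finS])
  \<comment> \<open>Regrouping the pairs by the lower member \<open>T\<close> leaves the subgroups
    between \<open>T\<close> and \<open>G\<close>, which correspond to the subgroups of the quotient
    by \<open>T\<close>.\<close>
  also have "\<dots> = card (SIGMA T:?T. {K. subgroup K G \<and> T \<subseteq> K})"
    by (rule bij_betw_same_card[of prod.swap])
      (auto simp: subgroup_relative_iff inj_on_def bij_betw_def image_iff)
  also have "\<dots> = (\<Sum>T\<in>?T. card {K. subgroup K G \<and> T \<subseteq> K})"
    by (rule card_SigmaI) (auto intro: finite_subset[OF _ finS])
  also have "\<dots> = (\<Sum>T\<in>?T. card (subgroup_lattice (G Mod T)))"
    by (rule sum.cong[OF refl])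
      (auto simp: subgroup_lattice_def subgroup_imp_normal
        intro!: bij_betw_same_card[OF normal.bij_betw_subgroups_FactGroup])
  finally show ?thesis .
qed


section \<open>Counting isomorphisms\<close>

text \<open>\<open>iso\<close> leaves the values outside the carrier free. Fixing them by
  extensionality makes the set finite for finite groups, and makes \<open>isos G G\<close> the
  carrier of \<open>AutoGroup G\<close>.\<close>

definition isos :: "('a, 'b) monoid_scheme \<Rightarrow> ('c, 'd) monoid_scheme \<Rightarrow> ('a \<Rightarrow> 'c) set" where
  "isos G H = iso G H \<inter> extensional (carrier G)"

lemma auto_eq_isos: "auto G = isos G G"
  by (auto simp: auto_def isos_def iso_def Bij_def)

lemma order_AutoGroup: "order (AutoGroup G) = card (isos G G)"
  by (simp add: AutoGroup_def order_def auto_eq_isos)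

lemma finite_isos:
  assumes "finite (carrier G)" "finite (carrier H)"
  shows "finite (isos G H)"
proof (rule finite_subset)
  show "isos G H \<subseteq> carrier G \<rightarrow>\<^sub>E carrier H"
    by (auto simp: isos_def iso_def hom_def PiE_def)
  show "finite (carrier G \<rightarrow>\<^sub>E carrier H)" using assms by (simp add: finite_PiE)
qed

lemma card_isos_self_pos:
  assumes "group G" "finite (carrier G)"
  shows "card (isos G G) > 0"
  using group.id_in_auto[OF assms(1)] finite_isos[OF assms(2,2)]
  by (auto simp: auto_eq_isos card_gt_0_iff)

text \<open>Composing with one fixed isomorphism from \<open>G\<close> to \<open>H\<close> turns
  automorphisms of \<open>G\<close> into isomorphisms onto \<open>H\<close>, and composing with its
  inverse undoes this.\<close>

lemma card_isos:
  assumes "group G"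
  shows "card (isos G H) = (if G \<cong> H then card (isos G G) else 0)"
proof (cases "G \<cong> H")
  case True
  then obtain g where g: "g \<in> iso G H" by (auto simp: is_iso_def)
  have bij: "bij_betw g (carrier G) (carrier H)" using g by (simp add: iso_def)
  define g' where "g' = inv_into (carrier G) g"
  have g': "g' \<in> iso H G" unfolding g'_def by (rule group.iso_set_sym[OF assms g])
  have 1: "g' (g x) = x" if "x \<in> carrier G" for x
    unfolding g'_def using bij that by (simp add: bij_betw_inv_into_left)
  have 2: "g (g' x) = x" if "x \<in> carrier H" for x
    unfolding g'_def using bij that by (simp add: bij_betw_inv_into_right)
  have comp: "compose (carrier G) i f \<in> isos G K'"
    if "f \<in> isos G K" "i \<in> iso K K'" for f i and K :: "('e, 'f) monoid_scheme" and K' :: "('g, 'h) monoid_scheme"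
    using group.iso_eq[OF assms, of "i \<circ> f" K' "compose (carrier G) i f"] iso_set_trans[of f G K i K'] that
    by (auto simp: isos_def compose_def)
  have "bij_betw (compose (carrier G) g) (isos G G) (isos G H)"
  proof (rule bij_betw_byWitness[where f' = "compose (carrier G) g'"])
    show "\<forall>f\<in>isos G G. compose (carrier G) g' (compose (carrier G) g f) = f"
      using 1 by (auto simp: isos_def iso_def hom_def compose_def fun_eq_iff extensional_def Pi_iff)
    show "\<forall>f\<in>isos G H. compose (carrier G) g (compose (carrier G) g' f) = f"
      using 2 by (auto simp: isos_def iso_def hom_def compose_def fun_eq_iff extensional_def Pi_iff)
    show "compose (carrier G) g ` isos G G \<subseteq> isos G H"
      "compose (carrier G) g' ` isos G H \<subseteq> isos G G"
      using comp[OF _ g] comp[OF _ g'] by auto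
  qed
  then show ?thesis using True by (simp add: bij_betw_same_card)
next
  case False
  then have "isos G H = {}" by (auto simp: isos_def is_iso_def)
  then show ?thesis using False by simp
qed

section \<open>Ordered triples of subgroups with prescribed pairwise meets and joins\<close>

lemma (in comm_group) subgroup_join_eq_set_mult:
  assumes A: "subgroup A G" and B: "subgroup B G"
  shows "subgroup_join G A B = A <#> B"
  unfolding subgroup_join_def
proof (rule generateI[symmetric])
  show "subgroup (A <#> B) G" by (rule mult_subgroups[OF A B])
  have "a \<in> A <#> B" if "a \<in> A" for a
    using that subgroup.one_closed[OF B] subgroup.mem_carrier[OF A]
    unfolding set_mult_def by (force intro: exI[of _ a])
  moreover have "b \<in> A <#> B" if "b \<in> B" for b
    using that subgroup.one_closed[OF A] subgroup.mem_carrier[OF B]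
    unfolding set_mult_def by (force intro: exI[of _ b])
  ultimately show "A \<union> B \<subseteq> A <#> B" by blast
  show "A <#> B \<subseteq> K" if "subgroup K G" "A \<union> B \<subseteq> K" for K
    using that subgroup.m_closed[OF that(1)] by (auto simp: set_mult_def)
qed

lemma set_multI: "a \<in> A \<Longrightarrow> b \<in> B \<Longrightarrow> a \<otimes>\<^bsub>G\<^esub> b \<in> A <#>\<^bsub>G\<^esub> B"
  by (auto simp: set_mult_def)

text \<open>Applied when a b and a c both lie in a subgroup \<open>C\<close>: the quotient of
  \<open>b\<close> and \<open>c\<close> then lies in \<open>C\<close> too, which makes the second
  factor unique once the first is given.\<close>

lemma (in group) inv_mult_cancel_left:
  assumes "a \<in> carrier G" "b \<in> carrier G" "c \<in> carrier G"
  shows "inv (a \<otimes> b) \<otimes> (a \<otimes> c) = inv b \<otimes> c"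
proof -
  have "inv a \<otimes> (a \<otimes> c) = c" using assms by (simp add: m_assoc[symmetric])
  then show ?thesis using assms by (simp add: inv_mult_group m_assoc)
qed

text \<open>Triples are ordered and may be degenerate: for \<open>H = K\<close> the triple (H, H, H)
  qualifies. The condition \<open>A \<noteq> B\<close> in \<open>diamond_triples\<close> removes
  this case.\<close>

definition span_triples ::
  "('a, 'b) monoid_scheme \<Rightarrow> 'a set \<Rightarrow> 'a set \<Rightarrow> ('a set \<times> 'a set \<times> 'a set) set" where
  "span_triples G H K = {(A, B, C). subgroup A G \<and> subgroup B G \<and> subgroup C G \<and>
     A \<inter> B = H \<and> B \<inter> C = H \<and> C \<inter> A = H \<and>
     subgroup_join G A B = K \<and> subgroup_join G B C = K \<and> subgroup_join G C A = K}"

lemma (in comm_group) span_triples_iff: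
  "(A, B, C) \<in> span_triples G H K \<longleftrightarrow> subgroup A G \<and> subgroup B G \<and> subgroup C G \<and>
     A \<inter> B = H \<and> B \<inter> C = H \<and> C \<inter> A = H \<and> A <#> B = K \<and> B <#> C = K \<and> C <#> A = K"
  by (auto simp: span_triples_def subgroup_join_eq_set_mult)

text \<open>An isomorphism \<open>\<phi>\<close> from \<open>S \<times>\<times> S\<close> is determined by the images of the two factors and
  of the diagonal together with its restriction to the first factor, and these data are arbitrary:
  the value \<open>\<phi> (\<one>, s)\<close> is the only element \<open>b\<close> of the second image such that \<open>\<phi> (s, \<one>) \<otimes> b\<close> lies in
  the image of the diagonal.\<close>

lemma (in comm_group) bij_betw_isos_span_triples:
  assumes S: "group S"
  shows "bij_betw (\<lambda>\<phi>. ((\<lambda>s. \<phi> (s, \<one>\<^bsub>S\<^esub>)) ` carrier S, (\<lambda>s. \<phi> (\<one>\<^bsub>S\<^esub>, s)) ` carrier S,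
             (\<lambda>s. \<phi> (s, s)) ` carrier S, \<lambda>s\<in>carrier S. \<phi> (s, \<one>\<^bsub>S\<^esub>)))
    (isos (S \<times>\<times> S) G)
    {(A, B, C, \<alpha>). (A, B, C) \<in> span_triples G {\<one>} (carrier G) \<and> \<alpha> \<in> isos S (G\<lparr>carrier := A\<rparr>)}"
  (is "bij_betw ?\<Phi> _ ?R")
proof -
  interpret S: group S by fact
  have fst_snd: "\<phi> (s, t) = \<phi> (s, \<one>\<^bsub>S\<^esub>) \<otimes> \<phi> (\<one>\<^bsub>S\<^esub>, t)"
    if "\<phi> \<in> iso (S \<times>\<times> S) G" "s \<in> carrier S" "t \<in> carrier S" for \<phi> s t
    using hom_mult[of \<phi> "S \<times>\<times> S" G "(s, \<one>\<^bsub>S\<^esub>)" "(\<one>\<^bsub>S\<^esub>, t)"] that by (simp add: iso_def)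
  have into: "?\<Phi> \<phi> \<in> ?R" if \<phi>: "\<phi> \<in> isos (S \<times>\<times> S) G" for \<phi>
  proof -
    have \<phi>i: "\<phi> \<in> iso (S \<times>\<times> S) G" using \<phi> by (simp add: isos_def)
    have \<phi>h: "\<phi> \<in> hom (S \<times>\<times> S) G" and inj: "inj_on \<phi> (carrier S \<times> carrier S)"
      and surj: "\<phi> ` (carrier S \<times> carrier S) = carrier G"
      using \<phi>i by (auto simp: iso_iff)
    have \<phi>c: "\<phi> (s, t) \<in> carrier G" if "s \<in> carrier S" "t \<in> carrier S" for s t
      using hom_in_carrier[OF \<phi>h, of "(s, t)"] that by simp
    have \<phi>m: "\<phi> (s, t) \<otimes> \<phi> (s', t') = \<phi> (s \<otimes>\<^bsub>S\<^esub> s', t \<otimes>\<^bsub>S\<^esub> t')"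
      if "s \<in> carrier S" "t \<in> carrier S" "s' \<in> carrier S" "t' \<in> carrier S" for s t s' t'
      using hom_mult[OF \<phi>h, of "(s, t)" "(s', t')"] that by simp
    have \<phi>1: "\<phi> (\<one>\<^bsub>S\<^esub>, \<one>\<^bsub>S\<^esub>) = \<one>"
      using hom_one[OF \<phi>h DirProd_group[OF S S] is_group] by simp
    define A B C where "A = (\<lambda>s. \<phi> (s, \<one>\<^bsub>S\<^esub>)) ` carrier S"
      and "B = (\<lambda>s. \<phi> (\<one>\<^bsub>S\<^esub>, s)) ` carrier S" and "C = (\<lambda>s. \<phi> (s, s)) ` carrier S"
    have hA: "group_hom S G (\<lambda>s. \<phi> (s, \<one>\<^bsub>S\<^esub>))" and hB: "group_hom S G (\<lambda>s. \<phi> (\<one>\<^bsub>S\<^esub>, s))"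
      and hC: "group_hom S G (\<lambda>s. \<phi> (s, s))"
      unfolding group_hom_def group_hom_axioms_def using S is_group \<phi>c \<phi>m
      by (auto intro!: homI)
    have sub: "subgroup A G" "subgroup B G" "subgroup C G"
      unfolding A_def B_def C_def using group_hom.img_is_subgroup[OF hA] group_hom.img_is_subgroup[OF hB]
        group_hom.img_is_subgroup[OF hC] by auto
    have eqD: "s = s' \<and> t = t'" if "\<phi> (s, t) = \<phi> (s', t')"
      "s \<in> carrier S" "t \<in> carrier S" "s' \<in> carrier S" "t' \<in> carrier S" for s t s' t'
      using inj_onD[OF inj that(1)] that by auto
    have "A \<inter> B \<subseteq> {\<one>}" "B \<inter> C \<subseteq> {\<one>}" "C \<inter> A \<subseteq> {\<one>}"
      using eqD \<phi>1 S.one_closed unfolding A_def B_def C_def by (safe; metis)+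
    then have int: "A \<inter> B = {\<one>}" "B \<inter> C = {\<one>}" "C \<inter> A = {\<one>}"
      using sub[THEN subgroup.one_closed] by auto
    have all: "\<exists>s\<in>carrier S. \<exists>t\<in>carrier S. x = \<phi> (s, t)" if "x \<in> carrier G" for x
      using that unfolding surj[symmetric] by auto
    have mem: "\<phi> (s, \<one>\<^bsub>S\<^esub>) \<in> A" "\<phi> (\<one>\<^bsub>S\<^esub>, s) \<in> B" "\<phi> (s, s) \<in> C" if "s \<in> carrier S" for s
      unfolding A_def B_def C_def using that by blast+
    have "x \<in> A <#> B" "x \<in> B <#> C" "x \<in> C <#> A" if x: "x \<in> carrier G" for x
    proof -
      obtain s t where st: "s \<in> carrier S" "t \<in> carrier S" "x = \<phi> (s, t)" using all[OF x] by auto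
      have "x = \<phi> (s, \<one>\<^bsub>S\<^esub>) \<otimes> \<phi> (\<one>\<^bsub>S\<^esub>, t)" using st \<phi>m by simp
      then show "x \<in> A <#> B" using st mem by (simp add: set_multI)
      \<comment> \<open>The decompositions come from (s, t) = (1, t s^-1)(s, s) and (s, t) = (t,
        t)(t^-1 s, 1); the sides are chosen so that the products cancel in \<open>S\<close> without
        commuting.\<close>
      have "x = \<phi> (\<one>\<^bsub>S\<^esub>, t \<otimes>\<^bsub>S\<^esub> inv\<^bsub>S\<^esub> s) \<otimes> \<phi> (s, s)" using st \<phi>m by (simp add: S.m_assoc)
      then show "x \<in> B <#> C" using st mem by (simp add: set_multI)
      have "x = \<phi> (t, t) \<otimes> \<phi> (inv\<^bsub>S\<^esub> t \<otimes>\<^bsub>S\<^esub> s, \<one>\<^bsub>S\<^esub>)"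
        using st \<phi>m by (simp add: S.m_assoc[symmetric])
      then show "x \<in> C <#> A" using st mem by (simp add: set_multI)
    qed
    then have join: "A <#> B = carrier G" "B <#> C = carrier G" "C <#> A = carrier G"
      using setmult_subset_G[OF sub(1,2)[THEN subgroup.subset]]
        setmult_subset_G[OF sub(2,3)[THEN subgroup.subset]]
        setmult_subset_G[OF sub(3,1)[THEN subgroup.subset]] by blast+
    have "(\<lambda>s\<in>carrier S. \<phi> (s, \<one>\<^bsub>S\<^esub>)) \<in> isos S (G\<lparr>carrier := A\<rparr>)"
    proof -
      have "(\<lambda>s. \<phi> (s, \<one>\<^bsub>S\<^esub>)) \<in> iso S (G\<lparr>carrier := A\<rparr>)"
        unfolding iso_iff A_def using \<phi>m eqD S.one_closed
        by (auto simp: hom_def intro!: inj_onI)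
      then have "(\<lambda>s\<in>carrier S. \<phi> (s, \<one>\<^bsub>S\<^esub>)) \<in> iso S (G\<lparr>carrier := A\<rparr>)"
        by (rule S.iso_eq) simp
      then show ?thesis by (simp add: isos_def)
    qed
    then show ?thesis
      using sub int join unfolding A_def B_def C_def by (simp add: span_triples_iff)
  qed
  have inj: "inj_on ?\<Phi> (isos (S \<times>\<times> S) G)"
  proof (rule inj_onI)
    fix \<phi> \<psi> assume \<phi>: "\<phi> \<in> isos (S \<times>\<times> S) G" and \<psi>: "\<psi> \<in> isos (S \<times>\<times> S) G" and eq: "?\<Phi> \<phi> = ?\<Phi> \<psi>"
    define B C where "B = (\<lambda>s. \<phi> (\<one>\<^bsub>S\<^esub>, s)) ` carrier S" and "C = (\<lambda>s. \<phi> (s, s)) ` carrier S"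
    have B': "B = (\<lambda>s. \<psi> (\<one>\<^bsub>S\<^esub>, s)) ` carrier S" and C': "C = (\<lambda>s. \<psi> (s, s)) ` carrier S"
      using eq by (simp_all add: B_def C_def)
    have BC: "subgroup B G" "subgroup C G" "B \<inter> C = {\<one>}"
      using into[OF \<phi>] by (auto simp: span_triples_iff B_def C_def)
    have \<phi>i: "\<phi> \<in> iso (S \<times>\<times> S) G" "\<psi> \<in> iso (S \<times>\<times> S) G" using \<phi> \<psi> by (simp_all add: isos_def)
    have cl: "\<phi> (s, t) \<in> carrier G" "\<psi> (s, t) \<in> carrier G" if "s \<in> carrier S" "t \<in> carrier S" for s t
      using hom_in_carrier[of \<phi> "S \<times>\<times> S" G "(s, t)"] hom_in_carrier[of \<psi> "S \<times>\<times> S" G "(s, t)"] \<phi>i that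
      by (auto simp: iso_def)
    have \<alpha>: "\<phi> (s, \<one>\<^bsub>S\<^esub>) = \<psi> (s, \<one>\<^bsub>S\<^esub>)" if "s \<in> carrier S" for s
      using eq that by (simp add: fun_eq_iff restrict_def) (metis)
    have \<beta>: "\<phi> (\<one>\<^bsub>S\<^esub>, s) = \<psi> (\<one>\<^bsub>S\<^esub>, s)" if s: "s \<in> carrier S" for s
    proof -
      define a b c where "a = \<phi> (s, \<one>\<^bsub>S\<^esub>)" and "b = \<phi> (\<one>\<^bsub>S\<^esub>, s)" and "c = \<psi> (\<one>\<^bsub>S\<^esub>, s)"
      have abc: "a \<in> carrier G" "b \<in> carrier G" "c \<in> carrier G"
        using cl s by (auto simp: a_def b_def c_def)
      have "b \<in> B" "c \<in> B" unfolding b_def c_def B_def using s B' B_def by auto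
      moreover have "\<phi> (s, s) \<in> C" unfolding C_def using s by blast
      moreover have "\<psi> (s, s) \<in> C" unfolding C' using s by blast
      moreover have "\<phi> (s, s) = a \<otimes> b" "\<psi> (s, s) = a \<otimes> c"
        using s fst_snd[OF \<phi>i(1) s s] fst_snd[OF \<phi>i(2) s s] \<alpha>[OF s] by (simp_all add: a_def b_def c_def)
      moreover have "inv (a \<otimes> b) \<otimes> (a \<otimes> c) = inv b \<otimes> c"
        using abc by (rule inv_mult_cancel_left)
      ultimately have "inv b \<otimes> c \<in> B \<inter> C"
        using BC by (metis IntI subgroup.m_closed subgroup.m_inv_closed)
      then have "inv b \<otimes> c = \<one>" using BC by simp
      then show ?thesis using abc unfolding b_def c_def
        by (metis inv_closed inv_equality inv_inv)
    qed
    show "\<phi> = \<psi>"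
    proof (rule extensionalityI)
      show "\<phi> \<in> extensional (carrier (S \<times>\<times> S))" "\<psi> \<in> extensional (carrier (S \<times>\<times> S))"
        using \<phi> \<psi> by (simp_all add: isos_def)
      fix x assume "x \<in> carrier (S \<times>\<times> S)"
      then obtain s t where st: "x = (s, t)" "s \<in> carrier S" "t \<in> carrier S" by auto
      show "\<phi> x = \<psi> x"
        unfolding st(1) fst_snd[OF \<phi>i(1) st(2,3)] fst_snd[OF \<phi>i(2) st(2,3)] \<alpha>[OF st(2)] \<beta>[OF st(3)] ..
    qed
  qed
  have "?R \<subseteq> ?\<Phi> ` isos (S \<times>\<times> S) G"
  proof
    fix x assume "x \<in> ?R"
    then obtain A B C \<alpha> where x: "x = (A, B, C, \<alpha>)" and tri: "(A, B, C) \<in> span_triples G {\<one>} (carrier G)"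
      and \<alpha>: "\<alpha> \<in> isos S (G\<lparr>carrier := A\<rparr>)" by auto
    have sub: "subgroup A G" "subgroup B G" "subgroup C G"
      and int: "A \<inter> B = {\<one>}" "B \<inter> C = {\<one>}" "C \<inter> A = {\<one>}"
      and join: "A <#> B = carrier G" "B <#> C = carrier G" "C <#> A = carrier G"
      using tri by (auto simp: span_triples_iff)
    note car = sub[THEN subgroup.mem_carrier]
    note ones = sub[THEN subgroup.one_closed]
    have \<alpha>h: "\<alpha> \<in> hom S (G\<lparr>carrier := A\<rparr>)" and \<alpha>inj: "inj_on \<alpha> (carrier S)"
      and \<alpha>surj: "\<alpha> ` carrier S = A" and \<alpha>ext: "\<alpha> \<in> extensional (carrier S)"
      using \<alpha> by (auto simp: isos_def iso_iff)
    have \<alpha>A: "\<alpha> s \<in> A" if "s \<in> carrier S" for s using \<alpha>surj that by auto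
    have \<alpha>m: "\<alpha> (s \<otimes>\<^bsub>S\<^esub> t) = \<alpha> s \<otimes> \<alpha> t" if "s \<in> carrier S" "t \<in> carrier S" for s t
      using hom_mult[OF \<alpha>h that] by simp
    have \<alpha>1: "\<alpha> \<one>\<^bsub>S\<^esub> = \<one>"
      using hom_one[OF \<alpha>h S subgroup_imp_group[OF sub(1)]] by simp
    \<comment> \<open>Writing a = b c with respect to \<open>B <#> C\<close>, the inverse of
      \<open>b\<close> moves \<open>a\<close> into \<open>C\<close>. With the uniqueness below,
      \<open>C\<close> becomes the graph of a map from \<open>A\<close> to \<open>B\<close>, and
      \<open>\<beta>\<close> is this map composed with \<open>\<alpha>\<close>.\<close>
    have ex: "\<exists>b\<in>B. a \<otimes> b \<in> C" if "a \<in> A" for a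
    proof -
      have "a \<in> B <#> C" using car(1)[OF that] join by simp
      then obtain b c where bc: "b \<in> B" "c \<in> C" "a = b \<otimes> c" by (auto simp: set_mult_def)
      then have "a \<otimes> inv b = c" using car by (simp add: m_comm[of b c] m_assoc)
      then show ?thesis using bc(1,2) subgroup.m_inv_closed[OF sub(2)] by metis
    qed
    define \<beta> where "\<beta> s = (SOME b. b \<in> B \<and> \<alpha> s \<otimes> b \<in> C)" for s
    have "\<beta> s \<in> B \<and> \<alpha> s \<otimes> \<beta> s \<in> C" if "s \<in> carrier S" for s
      unfolding \<beta>_def by (rule someI_ex) (use ex[OF \<alpha>A[OF that]] in blast)
    then have \<beta>B: "\<beta> s \<in> B" and \<beta>C: "\<alpha> s \<otimes> \<beta> s \<in> C" if "s \<in> carrier S" for s using that by auto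
    have uniq: "b = \<beta> s" if s: "s \<in> carrier S" and b: "b \<in> B" "\<alpha> s \<otimes> b \<in> C" for s b
    proof -
      have c: "\<alpha> s \<in> carrier G" "b \<in> carrier G" "\<beta> s \<in> carrier G"
        using \<alpha>A[OF s] b \<beta>B[OF s] car by auto
      have "inv (\<alpha> s \<otimes> b) \<otimes> (\<alpha> s \<otimes> \<beta> s) = inv b \<otimes> \<beta> s"
        using c by (rule inv_mult_cancel_left)
      then have "inv b \<otimes> \<beta> s \<in> B \<inter> C"
        using b \<beta>B[OF s] \<beta>C[OF s] sub by (metis IntI subgroup.m_closed subgroup.m_inv_closed)
      then have "inv b \<otimes> \<beta> s = \<one>" using int by simp
      then show ?thesis using c by (metis inv_closed inv_equality inv_inv)
    qed
    have \<beta>m: "\<beta> (s \<otimes>\<^bsub>S\<^esub> t) = \<beta> s \<otimes> \<beta> t" if st: "s \<in> carrier S" "t \<in> carrier S" for s t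
    proof (rule uniq[symmetric])
      show "\<beta> s \<otimes> \<beta> t \<in> B" using \<beta>B st subgroup.m_closed[OF sub(2)] by simp
      have "\<alpha> (s \<otimes>\<^bsub>S\<^esub> t) \<otimes> (\<beta> s \<otimes> \<beta> t) = (\<alpha> s \<otimes> \<beta> s) \<otimes> (\<alpha> t \<otimes> \<beta> t)"
        using st \<alpha>A \<beta>B car by (simp add: \<alpha>m m_ac)
      then show "\<alpha> (s \<otimes>\<^bsub>S\<^esub> t) \<otimes> (\<beta> s \<otimes> \<beta> t) \<in> C"
        using \<beta>C st subgroup.m_closed[OF sub(3)] by simp
    qed (use st in auto)
    have \<beta>1: "\<beta> \<one>\<^bsub>S\<^esub> = \<one>"
      using uniq[OF S.one_closed ones(2)] ones by (simp add: \<alpha>1)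
    \<comment> \<open>If b = c a with \<open>c\<close> in \<open>C\<close> and \<open>a\<close> in
      \<open>A\<close>, then the inverse of \<open>a\<close> times \<open>b\<close> is
      \<open>c\<close>, so \<open>b\<close> is the value of \<open>\<beta>\<close> at the
      \<open>s\<close> that \<open>\<alpha>\<close> sends to the inverse of
      \<open>a\<close>.\<close>
    have \<beta>surj: "\<exists>s\<in>carrier S. b = \<beta> s" if b: "b \<in> B" for b
    proof -
      have "b \<in> C <#> A" using car(2)[OF b] join by simp
      then obtain c a where ca: "c \<in> C" "a \<in> A" "b = c \<otimes> a" by (auto simp: set_mult_def)
      have "inv a \<in> A" using ca subgroup.m_inv_closed[OF sub(1)] by simp
      then obtain s where s: "s \<in> carrier S" "\<alpha> s = inv a" using \<alpha>surj by auto
      have "\<alpha> s \<otimes> b = c" using ca car s by (simp add: m_comm[of c a] m_assoc[symmetric])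
      then show ?thesis using uniq[OF s(1) b] ca s by auto
    qed
    define \<phi> where "\<phi> = (\<lambda>(s, t)\<in>carrier (S \<times>\<times> S). \<alpha> s \<otimes> \<beta> t)"
    have \<phi>st: "\<phi> (s, t) = \<alpha> s \<otimes> \<beta> t" if "s \<in> carrier S" "t \<in> carrier S" for s t
      using that by (simp add: \<phi>_def)
    have \<phi>hom: "\<phi> \<in> hom (S \<times>\<times> S) G"
      by (rule homI) (use \<alpha>A \<beta>B car in \<open>auto simp: \<phi>st \<alpha>m \<beta>m m_ac\<close>)
    have "inj_on \<phi> (carrier (S \<times>\<times> S))"
    proof (subst inj_on_one_iff'[OF \<phi>hom DirProd_group[OF S S] is_group], clarsimp)
      fix s t assume st: "s \<in> carrier S" "t \<in> carrier S" "\<phi> (s, t) = \<one>"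
      have ab: "\<alpha> s \<otimes> \<beta> t = \<one>" using st by (simp add: \<phi>st)
      then have "\<alpha> s = inv (\<beta> t)" using \<alpha>A \<beta>B car st by (metis inv_equality)
      then have "\<alpha> s \<in> B" using \<beta>B st subgroup.m_inv_closed[OF sub(2)] by simp
      then have "\<alpha> s \<in> A \<inter> B" using \<alpha>A st by simp
      then have a1: "\<alpha> s = \<one>" using int by simp
      then have s1: "s = \<one>\<^bsub>S\<^esub>" using \<alpha>inj st \<alpha>1 by (metis S.one_closed inj_onD)
      \<comment> \<open>Triviality of \<open>\<beta> t\<close> gives that of \<open>t\<close>
        through the third subgroup: \<open>\<alpha> t\<close> equals
        \<open>\<alpha> t \<otimes> \<beta> t\<close>, hence lies in both \<open>A\<close> and
        \<open>C\<close>.\<close>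
      have "\<beta> t = \<one>" using ab a1 \<beta>B car st by simp
      then have "\<alpha> t \<in> C \<inter> A" using \<beta>C[OF st(2)] \<alpha>A[OF st(2)] car by simp
      then have "\<alpha> t = \<one>" using int by simp
      then have "t = \<one>\<^bsub>S\<^esub>" using \<alpha>inj st \<alpha>1 by (metis S.one_closed inj_onD)
      with s1 show "s = \<one>\<^bsub>S\<^esub> \<and> t = \<one>\<^bsub>S\<^esub>" by simp
    qed
    moreover have "carrier G \<subseteq> \<phi> ` carrier (S \<times>\<times> S)"
    proof
      fix x assume "x \<in> carrier G"
      then have "x \<in> A <#> B" using join by simp
      then obtain a b where ab: "a \<in> A" "b \<in> B" "x = a \<otimes> b" by (auto simp: set_mult_def)
      obtain s where s: "s \<in> carrier S" "a = \<alpha> s" using ab \<alpha>surj by auto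
      obtain t where t: "t \<in> carrier S" "b = \<beta> t" using ab \<beta>surj by auto
      have "x = \<phi> (s, t)" using ab s t by (simp add: \<phi>st)
      then show "x \<in> \<phi> ` carrier (S \<times>\<times> S)" using s t by auto
    qed
    ultimately have "\<phi> \<in> iso (S \<times>\<times> S) G"
      using \<phi>hom by (auto simp: iso_iff hom_def)
    then have \<phi>in: "\<phi> \<in> isos (S \<times>\<times> S) G" by (simp add: isos_def \<phi>_def)
    have \<phi>x: "?\<Phi> \<phi> = x"
    proof -
      have "(\<lambda>s. \<phi> (s, \<one>\<^bsub>S\<^esub>)) ` carrier S = A"
        using \<alpha>A car by (simp add: \<phi>st \<beta>1 \<alpha>surj[symmetric])
      moreover have "(\<lambda>s. \<phi> (\<one>\<^bsub>S\<^esub>, s)) ` carrier S = B"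
        using \<beta>B \<beta>surj car by (auto simp: \<phi>st \<alpha>1)
      moreover have "(\<lambda>s. \<phi> (s, s)) ` carrier S = C"
      proof
        show "(\<lambda>s. \<phi> (s, s)) ` carrier S \<subseteq> C" using \<beta>C by (auto simp: \<phi>st)
        show "C \<subseteq> (\<lambda>s. \<phi> (s, s)) ` carrier S"
        proof
          fix c assume c: "c \<in> C"
          then have "c \<in> A <#> B" using car join by simp
          then obtain a b where ab: "a \<in> A" "b \<in> B" "c = a \<otimes> b" by (auto simp: set_mult_def)
          obtain s where s: "s \<in> carrier S" "a = \<alpha> s" using ab \<alpha>surj by auto
          have "b = \<beta> s" using uniq[OF s(1) ab(2)] ab c s by simp
          then have "c = \<phi> (s, s)" using ab s by (simp add: \<phi>st)
          then show "c \<in> (\<lambda>s. \<phi> (s, s)) ` carrier S" using s by auto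
        qed
      qed
      moreover have "(\<lambda>s\<in>carrier S. \<phi> (s, \<one>\<^bsub>S\<^esub>)) = \<alpha>"
        using \<alpha>ext \<alpha>A car by (auto simp: fun_eq_iff \<phi>st \<beta>1 extensional_def)
      ultimately show ?thesis by (simp add: x)
    qed
    show "x \<in> ?\<Phi> ` isos (S \<times>\<times> S) G" by (subst \<phi>x[symmetric]) (rule imageI[OF \<phi>in])
  qed
  then show ?thesis using inj into by (auto simp: bij_betw_def)
qed

text \<open>The bijection above counts triples together with an isomorphism from \<open>S\<close> to
  the first member. A fixed triple of type \<open>S\<close> admits \<open>card (isos S S)\<close> of
  these, independently of the triple.\<close>

lemma (in comm_group) card_span_triples_type:
  assumes S: "group S" and fin: "finite (carrier G)"
  shows "card {(A, B, C). (A, B, C) \<in> span_triples G {\<one>} (carrier G) \<and> S \<cong> G\<lparr>carrier := A\<rparr>} *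
      card (isos S S) = card (isos (S \<times>\<times> S) G)"
proof -
  let ?N = "{(A, B, C). (A, B, C) \<in> span_triples G {\<one>} (carrier G) \<and> S \<cong> G\<lparr>carrier := A\<rparr>}"
  let ?I = "\<lambda>t. isos S (G\<lparr>carrier := fst t\<rparr>)"
  let ?R = "{(A, B, C, \<alpha>). (A, B, C) \<in> span_triples G {\<one>} (carrier G) \<and> \<alpha> \<in> isos S (G\<lparr>carrier := A\<rparr>)}"
  have "finite (Pow (carrier G) \<times> Pow (carrier G) \<times> Pow (carrier G))" using fin by simp
  then have finN: "finite ?N"
    by (rule rev_finite_subset) (auto simp: span_triples_def dest: subgroup.subset)
  have "card (isos (S \<times>\<times> S) G) = card ?R"
    by (rule bij_betw_same_card[OF bij_betw_isos_span_triples[OF S]])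
  also have "\<dots> = card (SIGMA t:?N. ?I t)"
  proof (rule bij_betw_same_card[of "\<lambda>(A, B, C, \<alpha>). ((A, B, C), \<alpha>)"])
    show "bij_betw (\<lambda>(A, B, C, \<alpha>). ((A, B, C), \<alpha>)) ?R (SIGMA t:?N. ?I t)"
      by (rule bij_betw_byWitness[where f' = "\<lambda>((A, B, C), \<alpha>). (A, B, C, \<alpha>)"])
        (auto simp: isos_def is_iso_def)
  qed
  also have "\<dots> = (\<Sum>t\<in>?N. card (isos S S))"
  proof -
    have "finite (?I t) \<and> card (?I t) = card (isos S S)" if tN: "t \<in> ?N" for t
    proof -
      obtain A B C where t: "t = (A, B, C)" "subgroup A G" and iso: "S \<cong> G\<lparr>carrier := A\<rparr>"
        using tN unfolding span_triples_def by blast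
      have "finite A" using t fin subgroup.subset finite_subset by metis
      then show ?thesis
        using iso iso_finite[OF iso] finite_isos[of S "G\<lparr>carrier := A\<rparr>"]
          card_isos[OF S, of "G\<lparr>carrier := A\<rparr>"] by (simp add: t)
    qed
    then show ?thesis using finN by (simp add: card_SigmaI)
  qed
  finally show ?thesis by simp
qed


section \<open>Triples with given meet and join\<close>

text \<open>Each member lies below a join equal to \<open>K\<close>, so all triples with join
  \<open>K\<close> already live in \<open>K\<close>, where \<open>H\<close> can be factored
  out.\<close>

lemma (in comm_group) span_triples_relative:
  assumes K: "subgroup K G"
  shows "span_triples G H K = span_triples (G\<lparr>carrier := K\<rparr>) H K"
proof -
  interpret K: comm_group "G\<lparr>carrier := K\<rparr>" by (rule comm_group_subgroup[OF K])
  have sub: "A \<subseteq> K" if "subgroup A G" "subgroup B G" "A <#> B = K" for A B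
  proof
    fix a assume "a \<in> A"
    then have "a \<otimes> \<one> \<in> A <#> B" using subgroup.one_closed[OF that(2)] by (intro set_multI)
    then show "a \<in> K" using that subgroup.mem_carrier[OF that(1) \<open>a \<in> A\<close>] by simp
  qed
  have "(A, B, C) \<in> span_triples G H K \<longleftrightarrow> (A, B, C) \<in> span_triples (G\<lparr>carrier := K\<rparr>) H K" for A B C
    unfolding span_triples_iff K.span_triples_iff subgroup_relative_iff[OF K] set_mult_consistent
    using sub[of A B] sub[of B C] sub[of C A] by blast
  then show ?thesis by auto
qed

section \<open>Factoring out the common meet\<close>

lemma (in normal) coset_image_Int:
  assumes "subgroup A G" "subgroup B G" "H \<subseteq> B"
  shows "(#>) H ` (A \<inter> B) = (#>) H ` A \<inter> (#>) H ` B"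
proof
  show "(#>) H ` A \<inter> (#>) H ` B \<subseteq> (#>) H ` (A \<inter> B)"
  proof
    fix U assume "U \<in> (#>) H ` A \<inter> (#>) H ` B"
    then obtain a b where ab: "a \<in> A" "U = H #> a" "b \<in> B" "U = H #> b" by auto
    \<comment> \<open>\<open>B\<close> contains \<open>H\<close> and is thus a union of its cosets;
      therefore the representative \<open>a\<close> taken from \<open>A\<close> lies in
      \<open>B\<close> as well.\<close>
    have "a \<in> H #> b"
      using ab rcos_self[OF subgroup.mem_carrier[OF assms(1) ab(1)] subgroup_axioms] by simp
    then obtain h where "h \<in> H" "a = h \<otimes> b" by (auto simp: r_coset_def)
    then have "a \<in> B" using ab assms(3) subgroup.m_closed[OF assms(2)] by auto
    then show "U \<in> (#>) H ` (A \<inter> B)" using ab by auto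
  qed
qed auto

lemma (in normal) coset_image_set_mult:
  assumes "A \<subseteq> carrier G" "B \<subseteq> carrier G"
  shows "(#>) H ` (A <#> B) = ((#>) H ` A) <#>\<^bsub>G Mod H\<^esub> ((#>) H ` B)"
proof -
  have eq: "H #> (a \<otimes> b) = (H #> a) <#> (H #> b)" if "a \<in> A" "b \<in> B" for a b
    using assms that rcos_sum by (metis subsetD)
  show ?thesis
  proof
    show "(#>) H ` (A <#> B) \<subseteq> ((#>) H ` A) <#>\<^bsub>G Mod H\<^esub> ((#>) H ` B)"
    proof
      fix U assume "U \<in> (#>) H ` (A <#> B)"
      then obtain a b where ab: "a \<in> A" "b \<in> B" "U = H #> (a \<otimes> b)"
        by (auto simp: set_mult_def)
      have "(H #> a) \<otimes>\<^bsub>G Mod H\<^esub> (H #> b) \<in> ((#>) H ` A) <#>\<^bsub>G Mod H\<^esub> ((#>) H ` B)"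
        using ab by (intro set_multI imageI)
      then show "U \<in> ((#>) H ` A) <#>\<^bsub>G Mod H\<^esub> ((#>) H ` B)" using ab eq by simp
    qed
    show "((#>) H ` A) <#>\<^bsub>G Mod H\<^esub> ((#>) H ` B) \<subseteq> (#>) H ` (A <#> B)"
    proof
      fix U assume "U \<in> ((#>) H ` A) <#>\<^bsub>G Mod H\<^esub> ((#>) H ` B)"
      then obtain a b where "a \<in> A" "b \<in> B" "U = (H #> a) <#> (H #> b)"
        by (auto simp: set_mult_def[of "G Mod H"])
      then show "U \<in> (#>) H ` (A <#> B)" using eq by (metis imageI set_multI)
    qed
  qed
qed

text \<open>A plain equality, since both sides consist of the same cosets with the same product. It
  lets the type of the section from \<open>H\<close> to \<open>A\<close> be read inside the quotient
  by \<open>H\<close>.\<close>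

lemma (in normal) FactGroup_relative:
  assumes "subgroup A G" "H \<subseteq> A"
  shows "(G Mod H)\<lparr>carrier := (#>) H ` A\<rparr> = G\<lparr>carrier := A\<rparr> Mod H"
  by (auto simp: FactGroup_def RCOSETS_def intro!: ext)

text \<open>The correspondence between subgroups above \<open>H\<close> and subgroups of the
  quotient preserves meets and joins, and \<open>{H}\<close> is the trivial subgroup of
  \<open>G Mod H\<close>. This reduces arbitrary meets to the case of meet \<open>{\<one>}\<close>
  counted before.\<close>

lemma (in comm_group) bij_betw_span_triples_FactGroup:
  assumes H: "subgroup H G"
  shows "bij_betw (\<lambda>(A, B, C). ((#>) H ` A, (#>) H ` B, (#>) H ` C))
     (span_triples G H (carrier G)) (span_triples (G Mod H) {H} (carrier (G Mod H)))"
proof -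
  interpret normal H G by (rule subgroup_imp_normal[OF H])
  interpret Q: comm_group "G Mod H" by (rule abelian_FactGroup[OF H])
  let ?f = "\<lambda>A. (#>) H ` A" and ?S = "{K. subgroup K G \<and> H \<subseteq> K}"
  have bij: "bij_betw ?f ?S {A. subgroup A (G Mod H)}" by (rule bij_betw_subgroups_FactGroup)
  have fH: "?f H = {H}"
    using image_constant[OF subgroup.one_closed[OF H], of H]
    by (simp add: rcos_const[OF is_group] cong: image_cong)
  have fG: "?f (carrier G) = carrier (G Mod H)" by (simp add: carrier_FactGroup)
  have inj: "?f A = ?f B \<longleftrightarrow> A = B" if "A \<in> ?S" "B \<in> ?S" for A B
    using bij that by (meson bij_betw_def inj_on_eq_iff)
  have HS: "H \<in> ?S" "carrier G \<in> ?S" using H subset subgroup_self by auto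
  have int: "?f A \<inter> ?f B = {H} \<longleftrightarrow> A \<inter> B = H" if "A \<in> ?S" "B \<in> ?S" for A B
  proof -
    have "A \<inter> B \<in> ?S" using that subgroups_Inter_pair by auto
    then show ?thesis
      using inj[OF _ HS(1), of "A \<inter> B"] coset_image_Int[of A B] that fH by auto
  qed
  have join: "?f A <#>\<^bsub>G Mod H\<^esub> ?f B = carrier (G Mod H) \<longleftrightarrow> A <#> B = carrier G"
    if "A \<in> ?S" "B \<in> ?S" for A B
  proof -
    have "A \<subseteq> A <#> B"
    proof
      fix a assume "a \<in> A"
      then have "a \<otimes> \<one> \<in> A <#> B" using that subgroup.one_closed[of B G] by (intro set_multI) auto
      then show "a \<in> A <#> B" using that subgroup.mem_carrier[of A G a] \<open>a \<in> A\<close> by auto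
    qed
    then have "A <#> B \<in> ?S" using that mult_subgroups by auto
    then show ?thesis
      using inj[OF _ HS(2), of "A <#> B"] coset_image_set_mult[of A B] that fG
      by (metis (no_types, lifting) mem_Collect_eq subgroup.subset)
  qed
  have iff: "(?f A, ?f B, ?f C) \<in> span_triples (G Mod H) {H} (carrier (G Mod H)) \<longleftrightarrow>
      (A, B, C) \<in> span_triples G H (carrier G)"
    if "A \<in> ?S" "B \<in> ?S" "C \<in> ?S" for A B C
  proof -
    have sub: "subgroup (?f D) (G Mod H)" if "D \<in> ?S" for D
      using bij_betwE[OF bij] that by simp
    have abc: "subgroup A G" "subgroup B G" "subgroup C G" using that by simp_all
    show ?thesis
      unfolding span_triples_iff Q.span_triples_iff
        int[OF that(1,2)] int[OF that(2,3)] int[OF that(3,1)]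
        join[OF that(1,2)] join[OF that(2,3)] join[OF that(3,1)]
      by (simp only: sub[OF that(1)] sub[OF that(2)] sub[OF that(3)] abc simp_thms)
  qed
  have dom: "A \<in> ?S \<and> B \<in> ?S \<and> C \<in> ?S" if "(A, B, C) \<in> span_triples G H (carrier G)" for A B C
    using that by (auto simp: span_triples_def)
  have rng: "\<exists>A\<in>?S. U = ?f A" if "subgroup U (G Mod H)" for U
    using that bij_betw_imp_surj_on[OF bij] by (metis (no_types, lifting) imageE mem_Collect_eq)
  show ?thesis
    unfolding bij_betw_def
  proof
    show "inj_on (\<lambda>(A, B, C). (?f A, ?f B, ?f C)) (span_triples G H (carrier G))"
    proof (rule inj_onI)
      fix t t'
      assume t: "t \<in> span_triples G H (carrier G)" and t': "t' \<in> span_triples G H (carrier G)"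
        and eq: "(\<lambda>(A, B, C). (?f A, ?f B, ?f C)) t = (\<lambda>(A, B, C). (?f A, ?f B, ?f C)) t'"
      obtain A B C A' B' C' where tt': "t = (A, B, C)" "t' = (A', B', C')" by (metis prod.collapse)
      show "t = t'"
        using dom[of A B C] dom[of A' B' C'] t t' eq inj[of A A'] inj[of B B'] inj[of C C']
        unfolding tt' by simp
    qed
    show "(\<lambda>(A, B, C). (?f A, ?f B, ?f C)) ` span_triples G H (carrier G) =
        span_triples (G Mod H) {H} (carrier (G Mod H))"
    proof (rule equalityI; rule subsetI)
      fix t assume "t \<in> (\<lambda>(A, B, C). (?f A, ?f B, ?f C)) ` span_triples G H (carrier G)"
      then show "t \<in> span_triples (G Mod H) {H} (carrier (G Mod H))"
        using dom iff by (elim imageE) (simp split: prod.splits)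
    next
      fix t assume t: "t \<in> span_triples (G Mod H) {H} (carrier (G Mod H))"
      then obtain U V W where U: "t = (U, V, W)" "subgroup U (G Mod H)" "subgroup V (G Mod H)"
          "subgroup W (G Mod H)"
        by (auto simp: span_triples_def)
      from rng[OF U(2)] obtain A where A: "A \<in> ?S" "U = ?f A" by blast
      from rng[OF U(3)] obtain B where B: "B \<in> ?S" "V = ?f B" by blast
      from rng[OF U(4)] obtain C where C: "C \<in> ?S" "W = ?f C" by blast
      have "(A, B, C) \<in> span_triples G H (carrier G)"
        using t iff[OF A(1) B(1) C(1)] unfolding U A(2) B(2) C(2) by blast
      then show "t \<in> (\<lambda>(A, B, C). (?f A, ?f B, ?f C)) ` span_triples G H (carrier G)"
        unfolding U A(2) B(2) C(2) by (rule rev_image_eqI) simp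
    qed
  qed
qed

lemma (in comm_group) iso_sym_section:
  assumes "s \<in> sections G" "group S"
  shows "section_group G s \<cong> S \<longleftrightarrow> S \<cong> section_group G s"
  using group.iso_sym[OF assms(2)] group.iso_sym[OF group_section_group[OF assms(1)]] by blast

text \<open>Inside K / H the left-hand side counts the isomorphisms from S x S to K / H, of which
  there are |Aut(S x S)| or none. Keeping |Aut(S)| as a factor avoids division of natural
  numbers.\<close>

lemma (in comm_group) card_span_triples_section:
  assumes S: "group S" and fin: "finite (carrier G)" and HK: "(H, K) \<in> sections G"
  shows "card {(A, B, C). (A, B, C) \<in> span_triples G H K \<and> section_group G (H, A) \<cong> S} *
      order (AutoGroup S) =
      (if section_group G (H, K) \<cong> S \<times>\<times> S then order (AutoGroup (S \<times>\<times> S)) else 0)"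
proof -
  have K: "subgroup K G" and HK': "subgroup H G" "H \<subseteq> K"
    using HK by (auto simp: sections_comm[OF comm_group_axioms])
  let ?P = "G\<lparr>carrier := K\<rparr>"
  interpret P: comm_group ?P by (rule comm_group_subgroup[OF K])
  have H: "subgroup H ?P" using HK' by (simp add: subgroup_relative_iff[OF K])
  interpret normal H ?P by (rule P.subgroup_imp_normal[OF H])
  interpret Q: comm_group "?P Mod H" by (rule P.abelian_FactGroup[OF H])
  have finQ: "finite (carrier (?P Mod H))"
    using finite_subset[OF subgroup.subset[OF K] fin] by (simp add: carrier_FactGroup)
  let ?f = "\<lambda>A. (\<lambda>x. H #>\<^bsub>?P\<^esub> x) ` A" and ?Q = "?P Mod H"
  let ?L = "{(A, B, C). (A, B, C) \<in> span_triples G H K \<and> section_group G (H, A) \<cong> S}"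
  let ?R = "{(A, B, C). (A, B, C) \<in> span_triples ?Q {\<one>\<^bsub>?Q\<^esub>} (carrier ?Q) \<and> S \<cong> ?Q\<lparr>carrier := A\<rparr>}"
  have bij: "bij_betw (\<lambda>(A, B, C). (?f A, ?f B, ?f C)) (span_triples G H K)
      (span_triples ?Q {\<one>\<^bsub>?Q\<^esub>} (carrier ?Q))"
    using P.bij_betw_span_triples_FactGroup[OF H] span_triples_relative[OF K] by simp
  have type: "section_group G (H, A) \<cong> S \<longleftrightarrow> S \<cong> ?Q\<lparr>carrier := ?f A\<rparr>"
    if "(A, B, C) \<in> span_triples G H K" for A B C
  proof -
    have A: "subgroup A ?P" "H \<subseteq> A" "subgroup A G"
      using that unfolding span_triples_relative[OF K]
      by (auto simp: span_triples_def subgroup_relative_iff[OF K])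
    have "(H, A) \<in> sections G" using A HK' by (simp add: sections_comm[OF comm_group_axioms])
    then show ?thesis
      using iso_sym_section[OF _ S, of "(H, A)"] FactGroup_relative[OF A(1,2)] by simp
  qed
  have "bij_betw (\<lambda>(A, B, C). (?f A, ?f B, ?f C)) ?L ?R"
  proof (rule bij_betw_subset[OF bij])
    show "(\<lambda>(A, B, C). (?f A, ?f B, ?f C)) ` ?L = ?R"
    proof (rule equalityI; rule subsetI)
      fix t assume "t \<in> (\<lambda>(A, B, C). (?f A, ?f B, ?f C)) ` ?L"
      then show "t \<in> ?R" using type bij_betwE[OF bij] by fastforce
    next
      fix t assume "t \<in> ?R"
      then obtain U V W where t: "t = (U, V, W)"
        "(U, V, W) \<in> span_triples ?Q {\<one>\<^bsub>?Q\<^esub>} (carrier ?Q)" "S \<cong> ?Q\<lparr>carrier := U\<rparr>" by auto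
      then obtain A B C where "(A, B, C) \<in> span_triples G H K" "(U, V, W) = (?f A, ?f B, ?f C)"
        using bij_betw_imp_surj_on[OF bij] by (smt (verit, best) imageE case_prod_beta prod.collapse)
      then show "t \<in> (\<lambda>(A, B, C). (?f A, ?f B, ?f C)) ` ?L"
        using t type by (intro image_eqI[of _ _ "(A, B, C)"]) auto
    qed
  qed auto
  then have "card ?L * order (AutoGroup S) = card (isos (S \<times>\<times> S) ?Q)"
    using Q.card_span_triples_type[OF S finQ] by (simp add: bij_betw_same_card order_AutoGroup)
  also have "\<dots> = (if section_group G (H, K) \<cong> S \<times>\<times> S then order (AutoGroup (S \<times>\<times> S)) else 0)"
    using card_isos[OF DirProd_group[OF S S], of ?Q] iso_sym_section[OF HK DirProd_group[OF S S]]
    by (simp add: order_AutoGroup)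
  finally show ?thesis .
qed

text \<open>The inequality \<open>A \<noteq> B\<close> alone forces all five lattice elements to be
  distinct, as \<open>diamond_triplesD\<close> shows.\<close>

definition diamond_triples :: "('a, 'b) monoid_scheme \<Rightarrow> ('a set \<times> 'a set \<times> 'a set) set" where
  "diamond_triples G = {(A, B, C). A \<noteq> B \<and> (A, B, C) \<in> span_triples G (A \<inter> B) (subgroup_join G A B)}"

text \<open>The meet and the join of a triple single out one section, so the triples split over the
  sections of \<open>G\<close>, and each section of type S x S contributes the same number. For
  nontrivial \<open>S\<close> the degenerate triples do not enter, because there A / H is
  trivial.\<close>

lemma (in comm_group) card_diamond_triples_type:
  assumes S: "group S" "order S \<noteq> 1" and fin: "finite (carrier G)"
  shows "card {(A, B, C). (A, B, C) \<in> diamond_triples G \<and> section_group G (A \<inter> B, A) \<cong> S} *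
      order (AutoGroup S) = n_sections G (S \<times>\<times> S) * order (AutoGroup (S \<times>\<times> S))"
proof -
  let ?N = "\<lambda>(H, K). {(A, B, C). (A, B, C) \<in> span_triples G H K \<and> section_group G (H, A) \<cong> S}"
  have finS: "finite {K. subgroup K G}"
    by (rule rev_finite_subset[of "Pow (carrier G)"]) (auto simp: fin dest: subgroup.subset)
  have finsec: "finite (sections G)"
    by (rule rev_finite_subset[of "{K. subgroup K G} \<times> {K. subgroup K G}"])
      (auto simp: finS sections_def)
  have finN: "finite (?N s)" for s
    by (rule rev_finite_subset[of "{K. subgroup K G} \<times> {K. subgroup K G} \<times> {K. subgroup K G}"])
      (auto simp: finS span_triples_def split: prod.splits)
  have triv: "order (section_group G (A, A)) = 1" if "subgroup A G" for A
  proof -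
    have "carrier (section_group G (A, A)) = {A}"
      using that subgroup.one_closed[OF that] coset_join2[OF subgroup.mem_carrier[OF that] that]
      by (auto simp: carrier_FactGroup)
    then show ?thesis by (simp add: order_def)
  qed
  have "{(A, B, C). (A, B, C) \<in> diamond_triples G \<and> section_group G (A \<inter> B, A) \<cong> S} =
      (\<Union>s\<in>sections G. ?N s)" (is "?L = ?R")
  proof (rule equalityI; rule subsetI)
    fix t assume "t \<in> ?L"
    then obtain A B C where t: "t = (A, B, C)" "(A, B, C) \<in> span_triples G (A \<inter> B) (subgroup_join G A B)"
      "section_group G (A \<inter> B, A) \<cong> S" by (auto simp: diamond_triples_def)
    have AB: "subgroup A G" "subgroup B G" using t by (auto simp: span_triples_def)
    have "subgroup (subgroup_join G A B) G"
      unfolding subgroup_join_def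
      using AB[THEN subgroup.subset] by (intro generate_is_subgroup) auto
    moreover have "A \<subseteq> subgroup_join G A B"
      unfolding subgroup_join_def by (auto intro: generate.incl)
    ultimately have "(A \<inter> B, subgroup_join G A B) \<in> sections G"
      using AB subgroups_Inter_pair by (auto simp: sections_comm[OF comm_group_axioms])
    then show "t \<in> ?R" using t by (intro UN_I[of "(A \<inter> B, subgroup_join G A B)"]) auto
  next
    fix t assume "t \<in> ?R"
    then obtain H K A B C where t: "t = (A, B, C)" "(A, B, C) \<in> span_triples G H K"
      "section_group G (H, A) \<cong> S" by auto
    then have eq: "H = A \<inter> B" "K = subgroup_join G A B" and A: "subgroup A G" by (auto simp: span_triples_def)
    have "A \<noteq> B"
    proof
      assume "A = B"
      then have "order (section_group G (H, A)) = 1" using triv[OF A] eq by simp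
      then show False using t(3) S(2) iso_same_card by (metis order_def)
    qed
    then show "t \<in> ?L" using t eq by (simp add: diamond_triples_def)
  qed
  also have "card \<dots> = (\<Sum>s\<in>sections G. card (?N s))"
    by (rule card_UN_disjoint[OF finsec]) (use finN in \<open>auto simp: span_triples_def\<close>)
  finally have cardL: "card ?L = (\<Sum>s\<in>sections G. card (?N s))" .
  have "card ?L * order (AutoGroup S) = (\<Sum>s\<in>sections G. card (?N s) * order (AutoGroup S))"
    unfolding cardL by (rule sum_distrib_right)
  also have "\<dots> = (\<Sum>s\<in>sections G. if section_group G s \<cong> S \<times>\<times> S then order (AutoGroup (S \<times>\<times> S)) else 0)"
  proof (rule sum.cong[OF refl])
    fix s assume "s \<in> sections G"
    then show "card (?N s) * order (AutoGroup S) =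
        (if section_group G s \<cong> S \<times>\<times> S then order (AutoGroup (S \<times>\<times> S)) else 0)"
      using card_span_triples_section[OF S(1) fin, of "fst s" "snd s"] by (simp add: case_prod_beta)
  qed
  also have "\<dots> = n_sections G (S \<times>\<times> S) * order (AutoGroup (S \<times>\<times> S))"
    unfolding n_sections_def using finsec by (simp add: sum.If_cases Int_def)
  finally show ?thesis .
qed


section \<open>Diamonds\<close>

lemma (in comm_group) diamond_triplesD:
  assumes "(A, B, C) \<in> diamond_triples G"
  defines "H \<equiv> A \<inter> B" and "K \<equiv> subgroup_join G A B"
  shows "subgroup A G" "subgroup B G" "subgroup C G" "subgroup H G" "subgroup K G"
    and "H \<subseteq> A" "H \<subseteq> B" "H \<subseteq> C" "A \<subseteq> K" "B \<subseteq> K" "C \<subseteq> K"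
    and "distinct [H, A, B, C, K]"
proof -
  have t: "A \<noteq> B" "(A, B, C) \<in> span_triples G H K"
    using assms(1) by (auto simp: diamond_triples_def H_def K_def)
  show sub: "subgroup A G" "subgroup B G" "subgroup C G" using t by (auto simp: span_triples_def)
  then show "subgroup H G" by (simp add: H_def subgroups_Inter_pair)
  have int: "A \<inter> B = H" "B \<inter> C = H" "C \<inter> A = H" using t by (auto simp: span_triples_def)
  have join: "subgroup_join G A B = K" "subgroup_join G B C = K" "subgroup_join G C A = K"
    using t by (auto simp: span_triples_def)
  have le_join: "U \<subseteq> subgroup_join G U V" "V \<subseteq> subgroup_join G U V" for U V
    unfolding subgroup_join_def by (auto intro: generate.incl)
  have join_le: "subgroup_join G U V \<subseteq> W" if "subgroup W G" "U \<subseteq> W" "V \<subseteq> W" for U V W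
    unfolding subgroup_join_def using that by (intro generate_subgroup_incl) auto
  show "subgroup K G" unfolding K_def subgroup_join_def
    using sub[THEN subgroup.subset] by (intro generate_is_subgroup) auto
  show HA: "H \<subseteq> A" and HB: "H \<subseteq> B" and HC: "H \<subseteq> C" using int by auto
  show AK: "A \<subseteq> K" and BK: "B \<subseteq> K" and CK: "C \<subseteq> K" using le_join join by metis+
  \<comment> \<open>If one middle element were the bottom, its joins would make the other two equal
    to the top. For \<open>A\<close> or \<open>B\<close> the meet of the other two is then both
    \<open>H\<close> and \<open>K\<close>, and everything collapses; for \<open>C\<close> this gives
    \<open>A = B\<close> directly.\<close>
  have "A \<noteq> H" 
  proof
    assume "A = H"
    then have "K \<subseteq> B" "K \<subseteq> C" using join_le[of B A B] join_le[of C C A] join sub int by auto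
    then have "B = K" "C = K" using BK CK by auto
    then show False using int \<open>A = H\<close> \<open>A \<noteq> B\<close> by auto
  qed
  moreover have "B \<noteq> H"
  proof
    assume "B = H"
    then have "K \<subseteq> A" "K \<subseteq> C" using join_le[of A A B] join_le[of C B C] join sub int by auto
    then have "A = K" "C = K" using AK CK by auto
    then show False using int \<open>B = H\<close> \<open>A \<noteq> B\<close> by auto
  qed
  moreover have "C \<noteq> H"
  proof
    assume "C = H"
    then have "K \<subseteq> A" "K \<subseteq> B" using join_le[of A C A] join_le[of B B C] join sub int by auto
    then show False using AK BK \<open>A \<noteq> B\<close> by auto
  qed
  \<comment> \<open>Equal middle elements would coincide with their meet \<open>H\<close>. A middle
    element equal to \<open>K\<close> would contain the others, which would then be their meets with
    it, again \<open>H\<close>.\<close>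
  moreover have "B \<noteq> C" using \<open>B \<noteq> H\<close> int(2) by auto
  moreover have "C \<noteq> A" using \<open>C \<noteq> H\<close> int(3) by auto
  moreover have "A \<noteq> K" using \<open>B \<noteq> H\<close> int(1) BK by auto
  moreover have "B \<noteq> K" using \<open>A \<noteq> H\<close> int(1) AK by auto
  moreover have "C \<noteq> K" using \<open>A \<noteq> H\<close> int(3) AK by auto
  moreover have "H \<noteq> K" using \<open>A \<noteq> H\<close> HA AK by auto
  ultimately show "distinct [H, A, B, C, K]"
    unfolding distinct.simps list.set insert_iff empty_iff using t(1) by metis
qed

definition diamond_of :: "('a, 'b) monoid_scheme \<Rightarrow> 'a set \<times> 'a set \<times> 'a set \<Rightarrow> 'a set set" where
  "diamond_of G = (\<lambda>(A, B, C). {A \<inter> B, A, B, C, subgroup_join G A B})"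

lemma UNIV_m5: "UNIV = {Bottom, Mid1, Mid2, Mid3, Top}"
  by (auto intro: m5.exhaust)

lemma (in comm_group) is_diamond_iff:
  "is_diamond G D \<longleftrightarrow> D \<in> diamond_of G ` diamond_triples G"
proof
  assume "is_diamond G D"
  then obtain f where f: "bij_betw f (UNIV :: m5 set) D"
      "\<forall>x y. f (inf x y) = f x \<inter> f y \<and> f (sup x y) = subgroup_join G (f x) (f y)"
    unfolding is_diamond_def by blast
  have sub: "D \<subseteq> subgroup_lattice G"
    using \<open>is_diamond G D\<close> by (simp add: is_diamond_def is_sublattice_def)
  have D: "D = {f Bottom, f Mid1, f Mid2, f Mid3, f Top}"
    using bij_betw_imp_surj_on[OF f(1)] unfolding UNIV_m5 by simp
  have subf: "subgroup (f x) G" for x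
    using f(1) sub by (auto simp: bij_betw_def subgroup_lattice_def)
  have int: "f Mid1 \<inter> f Mid2 = f Bottom" "f Mid2 \<inter> f Mid3 = f Bottom" "f Mid3 \<inter> f Mid1 = f Bottom"
    by (simp_all add: inf_m5_def less_eq_m5_def flip: f(2)[rule_format, THEN conjunct1])
  have join: "subgroup_join G (f Mid1) (f Mid2) = f Top" "subgroup_join G (f Mid2) (f Mid3) = f Top"
    "subgroup_join G (f Mid3) (f Mid1) = f Top"
    by (simp_all add: sup_m5_def less_eq_m5_def flip: f(2)[rule_format, THEN conjunct2])
  have "f Mid1 \<noteq> f Mid2"
    using f(1) by (metis bij_betw_def inj_on_eq_iff UNIV_I m5.distinct(9))
  then have "(f Mid1, f Mid2, f Mid3) \<in> diamond_triples G"
    using int join subf by (simp add: diamond_triples_def span_triples_def)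
  moreover have "D = diamond_of G (f Mid1, f Mid2, f Mid3)"
    using D int join by (simp add: diamond_of_def)
  ultimately show "D \<in> diamond_of G ` diamond_triples G" by blast
next
  assume "D \<in> diamond_of G ` diamond_triples G"
  then obtain A B C where ABC: "(A, B, C) \<in> diamond_triples G" and D: "D = diamond_of G (A, B, C)"
    by auto
  define H K where "H = A \<inter> B" and "K = subgroup_join G A B"
  note d = diamond_triplesD[OF ABC, folded H_def K_def]
  have t: "(A, B, C) \<in> span_triples G H K" using ABC by (simp add: diamond_triples_def H_def K_def)
  have int: "A \<inter> B = H" "B \<inter> C = H" "C \<inter> A = H" using t by (auto simp: span_triples_def)
  have join: "subgroup_join G A B = K" "subgroup_join G B C = K" "subgroup_join G C A = K"
    using t by (auto simp: span_triples_def)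
  have join_comm: "subgroup_join G U V = subgroup_join G V U" for U V
    by (simp add: subgroup_join_def Un_commute)
  have join_le: "subgroup_join G U V = V" if "subgroup V G" "U \<subseteq> V" for U V
    unfolding subgroup_join_def using that by (intro generateI[symmetric]) auto
  define f where "f x = (case x of Bottom \<Rightarrow> H | Mid1 \<Rightarrow> A | Mid2 \<Rightarrow> B | Mid3 \<Rightarrow> C | Top \<Rightarrow> K)" for x
  have rng: "range f = D"
    unfolding UNIV_m5 D diamond_of_def using int join by (simp add: f_def)
  have "inj f"
  proof (rule injI)
    fix x y assume "f x = f y"
    then show "x = y" using d(12) by (cases x; cases y) (simp_all add: f_def)
  qed
  have meet: "f (inf x y) = f x \<inter> f y" for x y
    using d(6-11) int by (cases x; cases y) (auto simp: f_def inf_m5_def less_eq_m5_def)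
  have subf: "subgroup (f x) G" for x using d(1-5) by (cases x) (simp_all add: f_def)
  have mono: "f x \<subseteq> f y" if "x \<le> y" for x y
    using that meet[of x y] by (metis inf.absorb_iff1 inf_le2)
  \<comment> \<open>For comparable arguments the join is the larger one; only ordered pairs of
    distinct middle elements need the join equations of the triple.\<close>
  have joinf: "f (sup x y) = subgroup_join G (f x) (f y)" for x y
  proof (cases "x \<le> y \<or> y \<le> x")
    case True
    then show ?thesis
    proof
      assume "x \<le> y"
      then show ?thesis using join_le[OF subf mono] by (simp add: sup_absorb2)
    next
      assume "y \<le> x"
      then show ?thesis using join_le[OF subf mono, of y x] by (simp add: sup_absorb1 join_comm)
    qed
  next
    case False
    moreover have "subgroup_join G B A = K" "subgroup_join G C B = K" "subgroup_join G A C = K"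
      using join by (simp_all add: join_comm[of B A] join_comm[of C B] join_comm[of A C])
    ultimately show ?thesis
      using join by (cases x; cases y) (simp_all add: f_def sup_m5_def less_eq_m5_def)
  qed
  have "is_sublattice G D"
    unfolding is_sublattice_def rng[symmetric]
  proof (intro conjI ballI)
    show "range f \<subseteq> subgroup_lattice G" using subf by (auto simp: subgroup_lattice_def)
    fix U V assume "U \<in> range f" "V \<in> range f"
    then obtain x y where "U = f x" "V = f y" by blast
    then show "U \<inter> V \<in> range f" "subgroup_join G U V \<in> range f"
      by (simp_all only: meet[symmetric] joinf[symmetric] rangeI)
  qed simp
  moreover have "bij_betw f UNIV D" using rng \<open>inj f\<close> by (simp add: bij_betw_def)
  ultimately show "is_diamond G D"
    unfolding is_diamond_def using meet joinf by blast
qed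

section \<open>Orderings of the middle elements\<close>

lemma triple_set_eq_iff:
  assumes "distinct [a, b, c]"
  shows "{x, y, z} = {a, b, c} \<longleftrightarrow>
    (x, y, z) \<in> {(a, b, c), (a, c, b), (b, a, c), (b, c, a), (c, a, b), (c, b, a)}"
proof
  assume eq: "{x, y, z} = {a, b, c}"
  have "x \<in> {a, b, c}" "y \<in> {a, b, c}" "z \<in> {a, b, c}" unfolding eq[symmetric] by simp_all
  moreover have "a \<in> {x, y, z}" "b \<in> {x, y, z}" "c \<in> {x, y, z}" unfolding eq by simp_all
  ultimately show "(x, y, z) \<in> {(a, b, c), (a, c, b), (b, a, c), (b, c, a), (c, a, b), (c, b, a)}"
    using assms by auto
qed (auto simp: insert_commute)

lemma insert_Diff_ends: "distinct [h, a, b, c, k] \<Longrightarrow> {h, a, b, c, k} - {h, k} = {a, b, c}"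
  by auto

text \<open>This transposition and the rotation that follows generate all six orderings of a
  triple.\<close>

lemma (in comm_group) diamond_triples_swap:
  assumes "(A, B, C) \<in> diamond_triples G"
  shows "(B, A, C) \<in> diamond_triples G" "diamond_of G (B, A, C) = diamond_of G (A, B, C)"
proof -
  have comm: "subgroup_join G M N = subgroup_join G N M" for M N
    by (simp add: subgroup_join_def Un_commute)
  show "(B, A, C) \<in> diamond_triples G"
    using assms unfolding diamond_triples_def span_triples_def
    by (auto simp: comm[of B A] comm[of A C] comm[of C B] Int_commute[of B A] Int_commute[of A C] Int_commute[of C B])
  show "diamond_of G (B, A, C) = diamond_of G (A, B, C)"
    unfolding diamond_of_def by (simp add: comm[of B A] Int_commute[of B A] insert_commute[of B A])
qed

lemma (in comm_group) diamond_triples_rotate: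
  assumes "(A, B, C) \<in> diamond_triples G"
  shows "(B, C, A) \<in> diamond_triples G" "diamond_of G (B, C, A) = diamond_of G (A, B, C)"
proof -
  have eq: "B \<inter> C = A \<inter> B" "C \<inter> A = A \<inter> B" "subgroup_join G B C = subgroup_join G A B"
    "subgroup_join G C A = subgroup_join G A B"
    using assms by (simp_all add: diamond_triples_def span_triples_def)
  show "(B, C, A) \<in> diamond_triples G"
    using assms diamond_triplesD(12)[OF assms]
    by (simp add: diamond_triples_def span_triples_def eq)
  show "diamond_of G (B, C, A) = diamond_of G (A, B, C)"
    by (simp add: diamond_of_def eq insert_commute)
qed

text \<open>Bottom and top are the intersection and the union of all members of a diamond, so the
  set of its middle elements can be recovered from it. The fibre consists of the 3! orderings of
  this set.\<close>

lemma (in comm_group) card_diamond_of_fibre: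
  assumes ABC: "(A, B, C) \<in> diamond_triples G"
  shows "card {t \<in> diamond_triples G. diamond_of G t = diamond_of G (A, B, C)} = 6"
proof -
  have mid: "{U, V, W} = diamond_of G (U, V, W) - {\<Inter>(diamond_of G (U, V, W)), \<Union>(diamond_of G (U, V, W))}"
    if "(U, V, W) \<in> diamond_triples G" for U V W
  proof -
    note d = diamond_triplesD[OF that]
    have "\<Inter>(diamond_of G (U, V, W)) = U \<inter> V" "\<Union>(diamond_of G (U, V, W)) = subgroup_join G U V"
      using d(6-11) by (auto simp: diamond_of_def)
    then show ?thesis using insert_Diff_ends[OF d(12)] by (simp add: diamond_of_def)
  qed
  have closed: "(U, V, W) \<in> diamond_triples G \<and> diamond_of G (U, V, W) = diamond_of G (A, B, C)"
    if UVW: "{U, V, W} = {A, B, C}" for U V W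
  proof -
    have "distinct [A, B, C]" using diamond_triplesD(12)[OF ABC] by auto
    from UVW have cases: "(U, V, W) \<in> {(A, B, C), (A, C, B), (B, A, C), (B, C, A), (C, A, B), (C, B, A)}"
      unfolding triple_set_eq_iff[OF \<open>distinct [A, B, C]\<close>] .
    note rot = diamond_triples_rotate and swap = diamond_triples_swap
    have "(B, C, A) \<in> diamond_triples G" "(C, A, B) \<in> diamond_triples G"
      "(B, A, C) \<in> diamond_triples G" "(A, C, B) \<in> diamond_triples G" "(C, B, A) \<in> diamond_triples G"
      using rot(1) swap(1) ABC by blast+
    then show ?thesis
      using cases ABC rot(2)[of A B C] rot(2)[of B C A] swap(2)[of A B C] rot(2)[of B A C] rot(2)[of A C B]
      by (elim insertE emptyE) simp_all
  qed
  have dist: "distinct [A, B, C]" using diamond_triplesD(12)[OF ABC] by auto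
  have "{t \<in> diamond_triples G. diamond_of G t = diamond_of G (A, B, C)} =
      {(A, B, C), (A, C, B), (B, A, C), (B, C, A), (C, A, B), (C, B, A)}"
  proof (rule equalityI; rule subsetI)
    fix t assume t: "t \<in> {t \<in> diamond_triples G. diamond_of G t = diamond_of G (A, B, C)}"
    obtain U V W where UVW: "t = (U, V, W)" by (metis prod.collapse)
    have "{U, V, W} = {A, B, C}" using mid[OF ABC] mid[of U V W] t unfolding UVW by simp
    then show "t \<in> {(A, B, C), (A, C, B), (B, A, C), (B, C, A), (C, A, B), (C, B, A)}"
      unfolding UVW triple_set_eq_iff[OF dist] .
  next
    fix t assume t: "t \<in> {(A, B, C), (A, C, B), (B, A, C), (B, C, A), (C, A, B), (C, B, A)}"
    obtain U V W where UVW: "t = (U, V, W)" by (metis prod.collapse)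
    show "t \<in> {t \<in> diamond_triples G. diamond_of G t = diamond_of G (A, B, C)}"
      using closed[of U V W] t unfolding UVW triple_set_eq_iff[OF dist] by simp
  qed
  then show ?thesis using dist by simp
qed

lemma (in comm_group) card_diamond_triples:
  assumes fin: "finite (carrier G)"
  shows "card (diamond_triples G) = 6 * dm G"
proof -
  have "finite (Pow (carrier G) \<times> Pow (carrier G) \<times> Pow (carrier G))" using fin by simp
  then have finT: "finite (diamond_triples G)"
    by (rule rev_finite_subset) (auto simp: diamond_triples_def span_triples_def dest: subgroup.subset)
  have "card (diamond_triples G) =
      (\<Sum>D\<in>diamond_of G ` diamond_triples G. card {t \<in> diamond_triples G. diamond_of G t = D})"
    using sum.image_gen[OF finT, of "\<lambda>_. 1 :: nat" "diamond_of G"] by simp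
  also have "\<dots> = (\<Sum>D\<in>diamond_of G ` diamond_triples G. 6)"
    using card_diamond_of_fibre by (intro sum.cong) auto
  finally show ?thesis by (simp add: dm_def is_diamond_iff)
qed

section \<open>Summation over the isomorphism types\<close>

lemma section_typesE:
  assumes "S \<in> section_types G"
  obtains s where "s \<in> sections G" "S = section_group G s"
proof -
  obtain c where c: "c \<in> sections G // section_iso G" "S = section_group G (SOME s. s \<in> c)"
    using assms by (auto simp: section_types_def)
  have "(SOME s. s \<in> c) \<in> c"
    using in_quotient_imp_non_empty[OF equiv_section_iso c(1)] by (simp add: some_in_eq)
  then show thesis
    using that c in_quotient_imp_subset[OF equiv_section_iso c(1)] by blast
qed

lemma finite_section_types:
  assumes "finite (carrier G)"
  shows "finite (section_types G)"
proof -
  have "finite (Pow (carrier G) \<times> Pow (carrier G))" using assms by simp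
  then have "finite (sections G)"
    by (rule rev_finite_subset) (auto simp: sections_def dest: subgroup.subset)
  then have "finite (section_group G ` sections G)" by simp
  then show ?thesis
    by (rule rev_finite_subset) (auto elim!: section_typesE)
qed

text \<open>Each triple is sorted by the type of its section from \<open>A \<inter> B\<close> to
  \<open>A\<close>; existence and uniqueness of the representative in
  \<open>section_types_ex1\<close> make this a partition.\<close>

theorem (in comm_group) dm_eq_sum:
  assumes fin: "finite (carrier G)"
  shows "real (dm G) = (\<Sum>S\<in>{S \<in> section_types G. order S \<noteq> 1}.
         real (n_sections G (S \<times>\<times> S)) *
           (real (order (AutoGroup (S \<times>\<times> S))) / (6 * real (order (AutoGroup S)))))"
proof -
  let ?I = "{S \<in> section_types G. order S \<noteq> 1}"
  let ?D = "\<lambda>S. {(A, B, C). (A, B, C) \<in> diamond_triples G \<and> section_group G (A \<inter> B, A) \<cong> S}"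
  have "finite (Pow (carrier G) \<times> Pow (carrier G) \<times> Pow (carrier G))" using fin by simp
  then have finT: "finite (diamond_triples G)"
    by (rule rev_finite_subset) (auto simp: diamond_triples_def span_triples_def dest: subgroup.subset)
  have sec: "(A \<inter> B, A) \<in> sections G" if "(A, B, C) \<in> diamond_triples G" for A B C
    using diamond_triplesD(1,4)[OF that] by (simp add: sections_comm[OF comm_group_axioms])
  have "diamond_triples G = (\<Union>S\<in>?I. ?D S)"
  proof (rule equalityI; rule subsetI)
    fix t assume "t \<in> diamond_triples G"
    then obtain A B C where t: "t = (A, B, C)" "(A, B, C) \<in> diamond_triples G" by (metis prod.collapse)
    obtain S where S: "S \<in> section_types G" "section_group G (A \<inter> B, A) \<cong> S"
      using section_types_ex1[OF sec[OF t(2)]] by blast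
    \<comment> \<open>A trivial type would mean that \<open>A \<inter> B\<close> has index 1 in
      \<open>A\<close>, although the two are distinct. So leaving out the trivial type loses no
      triple.\<close>
    have "order S \<noteq> 1"
    proof
      assume "order S = 1"
      then have "card (rcosets\<^bsub>G\<lparr>carrier := A\<rparr>\<^esub> (A \<inter> B)) = 1"
        using iso_same_card[OF S(2)] by (simp add: order_def FactGroup_def)
      moreover have "subgroup (A \<inter> B) (G\<lparr>carrier := A\<rparr>)"
        using diamond_triplesD(1,4)[OF t(2)] by (simp add: subgroup_relative_iff)
      ultimately have "card (A \<inter> B) = card A"
        using group.lagrange[OF subgroup_imp_group[OF diamond_triplesD(1)[OF t(2)]], of "A \<inter> B"]
        by (simp add: order_def)
      moreover have "finite A"
        using finite_subset[OF subgroup.subset[OF diamond_triplesD(1)[OF t(2)]] fin] .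
      ultimately have "A \<inter> B = A" by (simp add: card_subset_eq)
      then show False using diamond_triplesD(12)[OF t(2)] by simp
    qed
    then show "t \<in> (\<Union>S\<in>?I. ?D S)" using t S by blast
  qed auto
  then have "card (diamond_triples G) = card (\<Union>S\<in>?I. ?D S)" by simp
  also have "\<dots> = (\<Sum>S\<in>?I. card (?D S))"
  proof (rule card_UN_disjoint)
    show "finite ?I" using finite_section_types[OF fin] by simp
    show "\<forall>S\<in>?I. finite (?D S)" by (auto intro: finite_subset[OF _ finT])
    show "\<forall>S\<in>?I. \<forall>S'\<in>?I. S \<noteq> S' \<longrightarrow> ?D S \<inter> ?D S' = {}"
      using section_types_ex1[OF sec] by blast
  qed
  finally have card: "6 * dm G = (\<Sum>S\<in>?I. card (?D S))"
    using card_diamond_triples[OF fin] by simp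
  have "real (card (?D S)) =
      6 * (real (n_sections G (S \<times>\<times> S)) * (real (order (AutoGroup (S \<times>\<times> S))) / (6 * real (order (AutoGroup S)))))"
    if S: "S \<in> ?I" for S
  proof -
    obtain s where s: "s \<in> sections G" "S = section_group G s" using S section_typesE by blast
    have gS: "group S" using s group_section_group by simp
    have "finite (carrier S)"
      using s fin by (cases s) (auto simp: sections_def carrier_FactGroup dest!: subgroup.subset intro: finite_subset)
    \<comment> \<open>Positivity allows the product identity between natural numbers to be solved
      for the number of triples as a real quotient.\<close>
    then have "order (AutoGroup S) > 0" using card_isos_self_pos[OF gS] by (simp add: order_AutoGroup)
    moreover have "real (card (?D S)) * real (order (AutoGroup S)) =
        real (n_sections G (S \<times>\<times> S)) * real (order (AutoGroup (S \<times>\<times> S)))"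
      unfolding of_nat_mult[symmetric] using card_diamond_triples_type[OF gS _ fin] S by simp
    ultimately show ?thesis by (simp add: field_simps)
  qed
  then have "6 * real (dm G) = 6 * (\<Sum>S\<in>?I. real (n_sections G (S \<times>\<times> S)) *
      (real (order (AutoGroup (S \<times>\<times> S))) / (6 * real (order (AutoGroup S)))))"
    using arg_cong[OF card, of real] by (simp add: sum_distrib_left)
  then show ?thesis by simp
qed

theorem theorem2p5:
  fixes G :: "('a, 'b) monoid_scheme" and p k :: nat
  assumes "Factorial_Ring.prime p"
    and "comm_group G" and "finite (carrier G)" and "order G = p ^ k"
  shows "real (dm G) =
      (\<Sum>S\<in>{S \<in> section_types G. order S \<noteq> 1}.
         real (n_sections G (S \<times>\<times> S)) *
           (real (order (AutoGroup (S \<times>\<times> S))) / (6 * real (order (AutoGroup S))))) \<and>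
    (\<forall>S\<in>section_types G.
       n_sections G (S \<times>\<times> S) =
         (\<Sum>T\<in>{T. subgroup T G \<and> G\<lparr>carrier := T\<rparr> \<cong> S \<times>\<times> S}.
            card (subgroup_lattice (G Mod T))))"
  using comm_group.dm_eq_sum[OF assms(2,3)] n_sections_eq_sum[OF assms] by blast


end
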